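(* There exist absolute constants $c_1,c_2>0$ such that for every $n\ge 1$ and every partial boolean function $f\colon\{0,1\}^n\to\{0,1,*\}$, \[ c_1\,\mathrm{R}(f)\;\le\;\mathrm{Corr}(f)\;\le\;c_2\,\mathrm{R}(f). \]
   Context: A partial boolean function $f\colon\{0,1\}^n\to\{0,1,*\}$ is defined on the domain $f^{-1}(0)\cup f^{-1}(1)$. $\mathrm{R}(f)=\mathrm{R}_{1/3}(f)$, where $\mathrm{R}_\epsilon(f)$ is the least number of queries (in the worst case) of a randomized decision tree that, on every input $x$ in the domain of $f$, outputs $f(x)$ with probability at least $1-\epsilon$. A balanced input distribution is $\mathcal D=\frac12\mathcal D_0+\frac12\mathcal D_1$, where $\mathcal D_b$ is a probability distribution supported on $f^{-1}(b)$. For a function $h$ and a distribution $\mu$ on its inputs, $\mathrm{D}_\epsilon(h,\mu)$ is the least depth of a deterministic decision tree that outputs $h(x)$ with probability at least $1-\epsilon$ over $x\sim\mu$. For $k\ge1$, $f^k\colon(\{0,1\}^n)^k\to\{0,1,*\}^k$ applies $f$ to each of $k$ disjoint inputs, and $\mathcal D_b^k$ is the $k$-fold product distribution. Define $\mathrm{Corr}_\epsilon(f,\mathcal D)=\min_{k\ge1}\mathrm{D}_\epsilon\big(f^k,\tfrac12\mathcal D_0^k+\tfrac12\mathcal D_1^k\big)$ (i.e., given query access to $k$ independent samples all from $\mathcal D_0$ or all from $\mathcal D_1$, decide which), and $\mathrm{Corr}_\epsilon(f)=\max_{\mathcal D}\mathrm{Corr}_\epsilon(f,\mathcal D)$ over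 balanced $\mathcal D$; $\mathrm{Corr}(f)=\mathrm{Corr}_{1/3}(f)$. *)

theory Defs
  imports "HOL-Probability.Probability"
begin

datatype ('q, 'o) dtree = Leaf 'o | Query 'q "('q, 'o) dtree" "('q, 'o) dtree"

text \<open>The input enters only through the answers \<open>ans :: 'q \<Rightarrow> bool\<close> it gives to the queries.\<close>

primrec run :: "('q, 'o) dtree \<Rightarrow> ('q \<Rightarrow> bool) \<Rightarrow> 'o" where
  "run (Leaf v) ans = v"
| "run (Query q l r) ans = (if ans q then run r ans else run l ans)"

primrec depth :: "('q, 'o) dtree \<Rightarrow> nat" where
  "depth (Leaf v) = 0"
| "depth (Query q l r) = Suc (max (depth l) (depth r))"

primrec queries :: "('q, 'o) dtree \<Rightarrow> 'q set" where
  "queries (Leaf v) = {}"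
| "queries (Query q l r) = insert q (queries l \<union> queries r)"

text \<open>
  A partial function on \<open>{0,1}\<^sup>n\<close> is a function \<open>f :: bool list \<Rightarrow> bool option\<close>, with \<open>None\<close> for
  the value \<open>*\<close>; everything below depends only on its values at lists of length \<open>n\<close>.
\<close>

definition fibre :: "nat \<Rightarrow> (bool list \<Rightarrow> bool option) \<Rightarrow> bool \<Rightarrow> bool list set" where
  "fibre n f b = {x. length x = n \<and> f x = Some b}"

text \<open>A randomized decision tree is a probability distribution over deterministic ones.\<close>

definition R_err :: "real \<Rightarrow> nat \<Rightarrow> (bool list \<Rightarrow> bool option) \<Rightarrow> nat" where
  "R_err \<epsilon> n f = (LEAST d. \<exists>P :: (nat, bool) dtree pmf.
     (\<forall>t\<in>set_pmf P. queries t \<subseteq> {..<n} \<and> depth t \<le> d) \<and>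
     (\<forall>b. \<forall>x\<in>fibre n f b. measure_pmf.prob P {t. run t (\<lambda>i. x ! i) = b} \<ge> 1 - \<epsilon>))"

text \<open>
  \<open>D\<^sub>\<epsilon>(h, \<mu>)\<close> for inputs of an arbitrary type: \<open>Q\<close> is the set of admissible queries, and
  \<open>rd x q\<close> is the answer of input \<open>x\<close> to query \<open>q\<close>.
\<close>

definition D_err ::
  "real \<Rightarrow> 'q set \<Rightarrow> ('x \<Rightarrow> 'q \<Rightarrow> bool) \<Rightarrow> ('x \<Rightarrow> 'o) \<Rightarrow> 'x pmf \<Rightarrow> nat" where
  "D_err \<epsilon> Q rd h \<mu> = (LEAST d. \<exists>t :: ('q, 'o) dtree.
     queries t \<subseteq> Q \<and> depth t \<le> d \<and>
     measure_pmf.prob \<mu> {x. run t (rd x) = h x} \<ge> 1 - \<epsilon>)"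

text \<open>
  A balanced distribution \<open>1/2 D\<^sub>0 + 1/2 D\<^sub>1\<close> is given by its two halves \<open>D False\<close> and \<open>D True\<close>,
  which it determines, as their supports are disjoint.
\<close>

definition balanced :: "nat \<Rightarrow> (bool list \<Rightarrow> bool option) \<Rightarrow> (bool \<Rightarrow> bool list pmf) set" where
  "balanced n f = {D. \<forall>b. set_pmf (D b) \<subseteq> fibre n f b}"

definition half_mix :: "(bool \<Rightarrow> 'a pmf) \<Rightarrow> 'a pmf" where
  "half_mix M = bind_pmf (bernoulli_pmf (1/2)) M"

text \<open>
  An input of \<open>f\<^sup>k\<close> is a list of \<open>k\<close> inputs of \<open>f\<close>; query \<open>(i, j)\<close> reads bit \<open>j\<close> of the \<open>i\<close>-th.
  On such lists \<open>f\<^sup>k\<close> is \<open>map f\<close>, and \<open>replicate_pmf k\<close> is the \<open>k\<close>-fold product distribution.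
\<close>

definition Corr_dist ::
  "real \<Rightarrow> nat \<Rightarrow> (bool list \<Rightarrow> bool option) \<Rightarrow> (bool \<Rightarrow> bool list pmf) \<Rightarrow> nat" where
  "Corr_dist \<epsilon> n f D = (INF k\<in>{1..}.
     D_err \<epsilon> ({..<k} \<times> {..<n}) (\<lambda>xs (i, j). xs ! i ! j) (map f)
       (half_mix (\<lambda>b. replicate_pmf k (D b))))"

text \<open>
  For \<open>\<epsilon> \<ge> 0\<close>, the values below are bounded by \<open>n\<close> (take \<open>k = 1\<close> and read the whole input), so the
  supremum in \<open>nat\<close> is a maximum. If \<open>f\<close> is constant on its domain, then there is no
  balanced distribution, and the supremum is \<open>0\<close>.
\<close>

definition Corr_err :: "real \<Rightarrow> nat \<Rightarrow> (bool list \<Rightarrow> bool option) \<Rightarrow> nat" where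
  "Corr_err \<epsilon> n f = (SUP D\<in>balanced n f. Corr_dist \<epsilon> n f D)"

abbreviation R :: "nat \<Rightarrow> (bool list \<Rightarrow> bool option) \<Rightarrow> nat" where
  "R \<equiv> R_err (1/3)"

abbreviation Corr :: "nat \<Rightarrow> (bool list \<Rightarrow> bool option) \<Rightarrow> nat" where
  "Corr \<equiv> Corr_err (1/3)"

end

theory Submission
  imports Defs
begin

text \<open>
  \<open>Corr \<le> R\<close> by averaging over the randomized tree and using a single sample (\<open>k = 1\<close>).

  For the converse let \<open>d = Corr n f\<close> and \<open>\<mu> = 1 / (300 * d)\<close>. A tree on one input whose leaves carry
  log-odds \<open>l\<close> pays \<open>wt b l * exp (\<mu> * cost)\<close> on an input of value \<open>b\<close>, where \<open>wt b l\<close> is \<open>exp (- l)\<close> or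
  \<open>exp l\<close>. For a balanced distribution, a depth-\<open>d\<close> tree \<open>T\<close> on \<open>k\<close> samples with bounded error makes the
  Hellinger distance of its transcripts under \<open>D\<^sub>0\<^sup>k\<close> and \<open>D\<^sub>1\<^sup>k\<close> at least a constant. By the cut-and-paste
  argument of Jayram, this is at most four times the sum over \<open>i\<close> of the squared distances caused by
  changing only the \<open>i\<close>-th sample to \<open>D\<^sub>1\<close>, whereas the queries to the separate samples sum to at most
  \<open>d\<close>. So for some \<open>i\<close> the restriction of \<open>T\<close> to the \<open>i\<close>-th sample, with log-likelihood ratios at the
  leaves, has expected payoff less than \<open>1\<close>. By the minimax principle there is a single random tree
  with expected payoff less than \<open>1\<close> on every input of the domain. Running independent copies of it
  until \<open>600 * d\<close> queries have been made and adding up the log-odds computes \<open>f\<close> with error at most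
  \<open>1/3\<close>.
\<close>

section \<open>Minimax over a finite index set\<close>

text \<open>A line separating \<open>S\<close> from the open quadrant has a normal with nonnegative
  entries because the quadrant is unbounded in both directions, and an offset at most
  \<open>0\<close> because the origin lies in the closure of the quadrant.\<close>

lemma quadrant_separation:
  fixes S :: "(real \<times> real) set"
  assumes "convex S" and "\<And>s t. (s, t) \<in> S \<Longrightarrow> s > 0 \<Longrightarrow> t > 0 \<Longrightarrow> False"
  obtains \<alpha> \<beta> where "\<alpha> \<ge> 0" "\<beta> \<ge> 0" "\<alpha> > 0 \<or> \<beta> > 0" "\<And>s t. (s, t) \<in> S \<Longrightarrow> \<alpha> * s + \<beta> * t \<le> 0"
proof (cases "S = {}")
  case True
  then show ?thesis using that[of 1 1] by auto
next
  case False
  define T :: "(real \<times> real) set" where "T = {0<..} \<times> {0<..}"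
  have "convex T" unfolding T_def by (intro convex_Times) auto
  moreover have "(1, 1) \<in> T" unfolding T_def by simp
  moreover have "S \<inter> T = {}" using assms(2) unfolding T_def by auto
  ultimately obtain a c where a: "a \<noteq> 0" "\<forall>x\<in>S. inner a x \<le> c" "\<forall>x\<in>T. inner a x \<ge> c"
    using separating_hyperplane_sets[OF assms(1) _ False, of T] by (metis empty_iff)
  obtain \<alpha> \<beta> where ab: "a = (\<alpha>, \<beta>)" by (cases a)
  have T: "c \<le> \<alpha> * s + \<beta> * t" if "s > 0" "t > 0" for s t
    using a(3) that by (auto simp: ab T_def inner_prod_def)
  have lim: "((\<lambda>r. \<alpha> * (r * s) + \<beta> * (r * t)) \<longlongrightarrow> \<alpha> * (0 * s) + \<beta> * (0 * t)) (at_right 0)" for s t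
    by (intro tendsto_intros)
  have "c \<le> \<alpha> * (0 * 1) + \<beta> * (0 * 1)"
    by (rule tendsto_lowerbound[OF lim])
       (auto simp: eventually_at_right_field intro!: exI[of _ 1] T)
  then have c: "c \<le> 0" by simp
  have pos: "0 \<le> x" if "\<And>s t. s > 0 \<Longrightarrow> t > 0 \<Longrightarrow> c \<le> x * s + y * t" for x y
  proof (rule ccontr)
    assume "\<not> 0 \<le> x"
    then have x: "x < 0" by simp
    \<comment> \<open>The first coordinate is chosen so that its product with \<open>x\<close> is
      too negative for \<open>c\<close> and \<open>y\<close> to compensate.\<close>
    have "c \<le> x * ((1 + \<bar>c\<bar> + \<bar>y\<bar>) / - x) + y * 1"
      using x by (intro that divide_pos_pos) auto
    also have "x * ((1 + \<bar>c\<bar> + \<bar>y\<bar>) / - x) = - (1 + \<bar>c\<bar> + \<bar>y\<bar>)"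
      using x by simp
    finally show False by simp
  qed
  have "\<alpha> \<ge> 0" using pos[OF T] .
  moreover have "\<beta> \<ge> 0" by (rule pos[of \<beta> \<alpha>], subst add.commute, rule T)
  ultimately show ?thesis
    using that[of \<alpha> \<beta>] a(1,2) c by (force simp: ab zero_prod_def)
qed

text \<open>Induction on \<open>X\<close>: weights on \<open>X\<close> are found for the part of
  \<open>K\<close> with \<open>v a > 0\<close>, and planar separation then balances their weighted
  sum against coordinate \<open>a\<close>.\<close>

lemma positive_orthant_separation:
  fixes K :: "('a \<Rightarrow> real) set"
  assumes "finite X" "X \<noteq> {}"
    and "\<And>u v s. u \<in> K \<Longrightarrow> v \<in> K \<Longrightarrow> 0 \<le> s \<Longrightarrow> s \<le> 1 \<Longrightarrow> (\<lambda>x. (1 - s) * u x + s * v x) \<in> K"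
    and "\<And>v. v \<in> K \<Longrightarrow> \<exists>x\<in>X. v x \<le> 0"
  shows "\<exists>D. (\<forall>x\<in>X. D x \<ge> 0) \<and> (\<exists>x\<in>X. D x > 0) \<and> (\<forall>v\<in>K. (\<Sum>x\<in>X. D x * v x) \<le> 0)"
  using assms
proof (induction X arbitrary: K rule: finite_ne_induct)
  case (singleton a)
  then show ?case by (intro exI[of _ "\<lambda>_. 1"]) auto
next
  case (insert a X)
  have conv: "(\<lambda>x. (1 - s) * u x + s * v x) \<in> {v \<in> K. v a > 0}"
    if "u \<in> {v \<in> K. v a > 0}" "v \<in> {v \<in> K. v a > 0}" "0 \<le> s" "s \<le> 1" for u v s
  proof -
    have "(1 - s) * u a + s * v a > 0"
      using that by (cases "s = 0") (auto intro!: add_nonneg_pos)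
    then show ?thesis using that insert.prems(1) by auto
  qed
  obtain D where D: "\<forall>x\<in>X. D x \<ge> 0" "\<exists>x\<in>X. D x > 0"
      "\<And>v. v \<in> K \<Longrightarrow> v a > 0 \<Longrightarrow> (\<Sum>x\<in>X. D x * v x) \<le> 0"
  proof -
    have "\<exists>x\<in>X. v x \<le> 0" if "v \<in> {v \<in> K. v a > 0}" for v
    proof -
      from that have "v \<in> K" "v a > 0" by auto
      with insert.prems(2)[of v] show ?thesis by force
    qed
    from insert.IH[of "{v \<in> K. v a > 0}", OF conv this]
    obtain D where "\<forall>x\<in>X. D x \<ge> 0" "\<exists>x\<in>X. D x > 0"
      "\<forall>v\<in>{v \<in> K. v a > 0}. (\<Sum>x\<in>X. D x * v x) \<le> 0" by blast
    then show ?thesis using that[of D] by blast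
  qed
  \<comment> \<open>This planar image of \<open>K\<close> misses the open quadrant by the choice of
    \<open>D\<close>.\<close>
  define S where "S = (\<lambda>v. (v a, \<Sum>x\<in>X. D x * v x)) ` K"
  have "convex S"
    unfolding convex_alt
  proof (intro ballI allI impI)
    fix y z and s :: real
    assume "y \<in> S" "z \<in> S" and s: "0 \<le> s \<and> s \<le> 1"
    then obtain u v where uv: "u \<in> K" "v \<in> K" "y = (u a, \<Sum>x\<in>X. D x * u x)"
      "z = (v a, \<Sum>x\<in>X. D x * v x)" by (auto simp: S_def)
    show "(1 - s) *\<^sub>R y + s *\<^sub>R z \<in> S"
      unfolding S_def
      by (rule image_eqI[OF _ insert.prems(1)[OF uv(1,2), of s]])
         (use s in \<open>auto simp: uv(3,4) sum_distrib_left sum.distrib sum_subtractf algebra_simps\<close>)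
  qed
  then obtain \<alpha> \<beta> where ab: "\<alpha> \<ge> 0" "\<beta> \<ge> 0" "\<alpha> > 0 \<or> \<beta> > 0"
      "\<And>s t. (s, t) \<in> S \<Longrightarrow> \<alpha> * s + \<beta> * t \<le> 0"
  proof (rule quadrant_separation)
    show False if "(s, t) \<in> S" "s > 0" "t > 0" for s t
      using that D(3) by (force simp: S_def)
  qed blast
  define E where "E = (\<lambda>x. if x = a then \<alpha> else \<beta> * D x)"
  have E: "(\<Sum>x\<in>insert a X. E x * v x) = \<alpha> * v a + \<beta> * (\<Sum>x\<in>X. D x * v x)" for v
    using insert.hyps by (simp add: E_def sum_distrib_left mult.assoc if_distrib cong: sum.cong)
      (rule sum.cong, auto)
  have "\<exists>x\<in>insert a X. E x > 0"
    using ab(3) D(2) insert.hyps by (auto simp: E_def)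
  moreover have "\<forall>x\<in>insert a X. E x \<ge> 0"
    using ab D(1) by (auto simp: E_def)
  moreover have "\<forall>v\<in>K. (\<Sum>x\<in>insert a X. E x * v x) \<le> 0"
    unfolding E using ab(4) by (auto simp: S_def)
  ultimately show ?case by (intro exI[of _ E]) blast
qed

text \<open>\<open>K\<close> collects the slacks \<open>1 - E g\<close> of finitely supported
  mixtures and is closed under convex combination. If no slack were positive on all of
  \<open>X\<close>, separation would yield weights \<open>D\<close> against which every single
  \<open>t\<close> pays at least the total weight, contrary to the hypothesis.\<close>

lemma finite_minimax:
  fixes g :: "'t \<Rightarrow> 'a \<Rightarrow> real"
  assumes "finite X" "X \<noteq> {}"
    and "\<And>D. (\<forall>x\<in>X. D x \<ge> 0) \<Longrightarrow> \<exists>x\<in>X. D x > 0 \<Longrightarrow> \<exists>t\<in>S. (\<Sum>x\<in>X. D x * g t x) < (\<Sum>x\<in>X. D x)"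
  obtains P where "finite (set_pmf P)" "set_pmf P \<subseteq> S"
    "\<And>x. x \<in> X \<Longrightarrow> measure_pmf.expectation P (\<lambda>t. g t x) < 1"
proof -
  define K where "K = {v. \<exists>P. finite (set_pmf P) \<and> set_pmf P \<subseteq> S \<and>
     v = (\<lambda>x. 1 - measure_pmf.expectation P (\<lambda>t. g t x))}"
  have point: "(\<lambda>x. 1 - g t x) \<in> K" if "t \<in> S" for t
    unfolding K_def using that by (auto intro!: exI[of _ "return_pmf t"])
  have conv: "(\<lambda>x. (1 - s) * u x + s * v x) \<in> K"
    if uv: "u \<in> K" "v \<in> K" and s: "0 \<le> s" "s \<le> 1" for u v s
  proof -
    obtain P Q where P: "finite (set_pmf P)" "set_pmf P \<subseteq> S"
        "u = (\<lambda>x. 1 - measure_pmf.expectation P (\<lambda>t. g t x))"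
      and Q: "finite (set_pmf Q)" "set_pmf Q \<subseteq> S"
        "v = (\<lambda>x. 1 - measure_pmf.expectation Q (\<lambda>t. g t x))"
      using uv unfolding K_def by blast
    define M where "M = bind_pmf (bernoulli_pmf s) (\<lambda>b. if b then Q else P)"
    have "measure_pmf.expectation M (\<lambda>t. g t x) =
        (\<Sum>b\<in>UNIV. pmf (bernoulli_pmf s) b *\<^sub>R measure_pmf.expectation (if b then Q else P) (\<lambda>t. g t x))" for x
      unfolding M_def by (rule pmf_expectation_bind) (use P Q in auto)
    then have "measure_pmf.expectation M (\<lambda>t. g t x) =
       s * measure_pmf.expectation Q (\<lambda>t. g t x) + (1 - s) * measure_pmf.expectation P (\<lambda>t. g t x)" for x
      using s by (simp add: UNIV_bool)
    then have "(\<lambda>x. (1 - s) * u x + s * v x) = (\<lambda>x. 1 - measure_pmf.expectation M (\<lambda>t. g t x))"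
      by (auto simp: P Q algebra_simps)
    moreover have "set_pmf M \<subseteq> set_pmf P \<union> set_pmf Q" by (auto simp: M_def split: if_splits)
    ultimately show ?thesis
      unfolding K_def using P Q
      by (intro CollectI exI[of _ M] conjI) (auto intro: finite_subset[of _ "set_pmf P \<union> set_pmf Q"])
  qed
  have "\<exists>v\<in>K. \<forall>x\<in>X. v x > 0"
  proof (rule ccontr)
    assume "\<not> ?thesis"
    then have "\<And>v. v \<in> K \<Longrightarrow> \<exists>x\<in>X. v x \<le> 0" by force
    from positive_orthant_separation[OF assms(1,2) conv this]
    obtain D where D: "\<forall>x\<in>X. D x \<ge> 0" "\<exists>x\<in>X. D x > 0" "\<And>v. v \<in> K \<Longrightarrow> (\<Sum>x\<in>X. D x * v x) \<le> 0"
      by blast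
    obtain t where t: "t \<in> S" "(\<Sum>x\<in>X. D x * g t x) < (\<Sum>x\<in>X. D x)"
      using assms(3)[OF D(1,2)] by blast
    from D(3)[OF point[OF t(1)]] t(2) show False
      by (simp add: algebra_simps sum_subtractf)
  qed
  then show ?thesis using that by (auto simp: K_def)
qed

section \<open>Amplification of forecasts\<close>

primrec cost :: "('q, 'o) dtree \<Rightarrow> ('q \<Rightarrow> bool) \<Rightarrow> nat" where
  "cost (Leaf v) ans = 0"
| "cost (Query q l r) ans = Suc (if ans q then cost r ans else cost l ans)"

text \<open>
  Leaves of forecasting trees carry log-odds in favour of the value \<open>True\<close>; \<open>wt b l\<close> is small when the
  forecast \<open>l\<close> supports the correct value \<open>b\<close>.
\<close>

definition wt :: "bool \<Rightarrow> real \<Rightarrow> real" where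
  "wt b l = exp (if b then - l else l)"

text \<open>Log-odds and costs add up along trees run one after another, so payoffs of independent
  copies multiply.\<close>

definition pay :: "real \<Rightarrow> ('q, real) dtree \<Rightarrow> bool \<Rightarrow> ('q \<Rightarrow> bool) \<Rightarrow> real" where
  "pay \<mu> t b ans = wt b (run t ans) * exp (\<mu> * cost t ans)"

lemma wt_pos: "wt b l > 0" by (simp add: wt_def)

lemma wt_add: "wt b (l + l') = wt b l * wt b l'"
  by (simp add: wt_def flip: exp_add)

text \<open>The counter hands the number of queries made so far to the continuation, so that a
  budget can be enforced across grafted trees.\<close>

primrec graft :: "('q, real) dtree \<Rightarrow> (nat \<Rightarrow> real \<Rightarrow> ('q, 'o) dtree) \<Rightarrow> nat \<Rightarrow> ('q, 'o) dtree" where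
  "graft (Leaf l) k c = k c l"
| "graft (Query q t u) k c = Query q (graft t k (Suc c)) (graft u k (Suc c))"

lemma run_graft: "run (graft t k c) ans = run (k (c + cost t ans) (run t ans)) ans"
  by (induction t arbitrary: c) auto

lemma queries_graft:
  assumes "queries t \<subseteq> Q" "\<And>c l. queries (k c l) \<subseteq> Q"
  shows "queries (graft t k c) \<subseteq> Q"
  using assms(1) by (induction t arbitrary: c) (auto simp: assms(2) dest: subsetD[OF assms(2)])

lemma depth_graft:
  assumes "\<And>c l. c \<le> D \<Longrightarrow> depth (k c l) \<le> D - c" "c + depth t \<le> D"
  shows "depth (graft t k c) \<le> D - c"
  using assms(2)
proof (induction t arbitrary: c)
  case (Leaf x)
  then show ?case using assms(1)[of c x] by simp
next
  case (Query q t u)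
  then have "Suc c + depth t \<le> D" "Suc c + depth u \<le> D" by simp_all
  from Query.IH(1)[OF this(1)] Query.IH(2)[OF this(2)] this show ?case by simp
qed

text \<open>The budget is tested only between trees. A tree begun with fewer than \<open>B\<close>
  queries made is run to its end, hence the extra \<open>d\<close> in
  \<open>depth_vote\<close>.\<close>

primrec vote :: "nat \<Rightarrow> ('q, real) dtree list \<Rightarrow> nat \<Rightarrow> real \<Rightarrow> ('q, bool) dtree" where
  "vote B [] c s = Leaf (s > 0)"
| "vote B (t # ts) c s = (if B \<le> c then Leaf (s > 0) else graft t (\<lambda>c' l. vote B ts c' (s + l)) c)"

lemma queries_vote:
  assumes "\<And>t. t \<in> set ts \<Longrightarrow> queries t \<subseteq> Q"
  shows "queries (vote B ts c s) \<subseteq> Q"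
  using assms
proof (induction ts arbitrary: c s)
  case (Cons t ts)
  then have "queries (graft t (\<lambda>c' l. vote B ts c' (s + l)) c) \<subseteq> Q"
    by (intro queries_graft) auto
  then show ?case by simp
qed simp

lemma depth_vote:
  assumes "\<And>t. t \<in> set ts \<Longrightarrow> depth t \<le> d" "c \<le> B + d"
  shows "depth (vote B ts c s) \<le> B + d - c"
  using assms
proof (induction ts arbitrary: c s)
  case Nil
  then show ?case by simp
next
  case (Cons t ts)
  have "depth (graft t (\<lambda>c' l. vote B ts c' (s + l)) c) \<le> (B + d) - c" if "c < B"
    by (rule depth_graft) (use Cons that in \<open>auto simp: add_mono\<close>)
  then show ?case by auto
qed

lemma measure_bind_pmf:
  "measure (measure_pmf (bind_pmf M N)) A = measure_pmf.expectation M (\<lambda>x. measure (measure_pmf (N x)) A)"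
proof -
  have "ennreal (measure (measure_pmf (bind_pmf M N)) A) = (\<integral>\<^sup>+x. ennreal (measure (measure_pmf (N x)) A) \<partial>M)"
    by (simp add: measure_pmf.emeasure_eq_measure[symmetric])
  also have "\<dots> = ennreal (measure_pmf.expectation M (\<lambda>x. measure (measure_pmf (N x)) A))"
    by (intro nn_integral_eq_integral measure_pmf.integrable_const_bound[where B=1]) auto
  finally show ?thesis
    by (subst (asm) ennreal_inj) (auto intro!: integral_nonneg_AE)
qed

text \<open>
  The product of the payoffs is a supermartingale, so when the budget \<open>B\<close> is used up, \<open>wt b s\<close> has
  expectation at most \<open>exp (- \<mu> * B)\<close>, while a wrong final sign of \<open>s\<close> means \<open>wt b s \<ge> 1\<close>. The term
  \<open>\<rho> ^ m\<close> accounts for the event that \<open>m\<close> trees do not use up the budget.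
\<close>

lemma vote_error:
  fixes P :: "('q, real) dtree pmf"
  assumes "finite (set_pmf P)" "\<mu> \<ge> 0" "0 \<le> \<rho>" "\<rho> \<le> 1"
    and "measure_pmf.expectation P (\<lambda>t. pay \<mu> t b ans) \<le> \<rho>"
  shows "measure_pmf.prob (replicate_pmf m P) {ts. run (vote B ts c s) ans \<noteq> b}
    \<le> wt b s * (exp (\<mu> * (real c - real B)) + \<rho> ^ m)"
proof (induction m arbitrary: c s)
  \<comment> \<open>A wrong sign makes the exponent in \<open>wt b s\<close> nonnegative; the tie
    \<open>s = 0\<close> has weight exactly \<open>1\<close>.\<close>
  have wrong: "of_bool ((s > 0) \<noteq> b) \<le> wt b s" for s
    by (auto simp: wt_def)
  {
    case 0
    have "measure_pmf.prob (replicate_pmf 0 P) {ts. run (vote B ts c s) ans \<noteq> b} = of_bool ((s > 0) \<noteq> b)"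
      by (simp add: indicator_def)
    also have "\<dots> \<le> wt b s" by (rule wrong)
    also have "\<dots> \<le> wt b s * (exp (\<mu> * (real c - real B)) + \<rho> ^ 0)"
      using wt_pos[of b s] by (simp add: distrib_left)
    finally show ?case .
  next
    case (Suc m)
    show ?case
    proof (cases "B \<le> c")
      case True
      have "measure_pmf.prob (replicate_pmf (Suc m) P) {ts. run (vote B ts c s) ans \<noteq> b}
          = measure_pmf.prob (replicate_pmf (Suc m) P) {ts. (s > 0) \<noteq> b}"
        by (intro measure_pmf.finite_measure_eq_AE)
           (auto simp: AE_measure_pmf_iff True set_replicate_pmf length_Suc_conv)
      also have "\<dots> \<le> of_bool ((s > 0) \<noteq> b)" by auto
      also have "\<dots> \<le> wt b s * 1" using wrong by simp
      also have "\<dots> \<le> wt b s * (exp (\<mu> * (real c - real B)) + \<rho> ^ Suc m)"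
        using True assms(2,3) wt_pos[of b s]
        by (intro mult_left_mono add_increasing2) (auto simp: less_imp_le)
      finally show ?thesis .
    next
      case False
      let ?S = "set_pmf P"
      define e where "e = exp (\<mu> * (real c - real B))"
      have E: "measure_pmf.expectation P f = (\<Sum>t\<in>?S. pmf P t * f t)" for f :: "('q, real) dtree \<Rightarrow> real"
        using integral_measure_pmf[OF assms(1), of P f] by simp
      have "measure_pmf.prob (replicate_pmf (Suc m) P) {ts. run (vote B ts c s) ans \<noteq> b}
          = (\<Sum>t\<in>?S. pmf P t * measure_pmf.prob (replicate_pmf m P)
               {ts. run (vote B ts (c + cost t ans) (s + run t ans)) ans \<noteq> b})"
        using False by (simp add: measure_bind_pmf E run_graft map_pmf_def[symmetric] vimage_def)
      also have "\<dots> \<le> (\<Sum>t\<in>?S. pmf P t * (wt b (s + run t ans) *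
          (exp (\<mu> * (real (c + cost t ans) - real B)) + \<rho> ^ m)))"
        by (intro sum_mono mult_left_mono Suc.IH) auto
      also have "\<dots> \<le> (\<Sum>t\<in>?S. pmf P t * (wt b s * (e + \<rho> ^ m) * pay \<mu> t b ans))"
      proof (intro sum_mono mult_left_mono)
        fix t :: "('q, real) dtree"
        have *: "exp (\<mu> * (real (c + cost t ans) - real B)) = e * exp (\<mu> * cost t ans)"
          by (simp add: e_def algebra_simps flip: exp_add)
        \<comment> \<open>A factor \<open>exp (\<mu> * cost t ans)\<close>, which is at least
          \<open>1\<close>, is inserted into the second term so that \<open>pay\<close> can be
          factored out of both.\<close>
        have "wt b s * (wt b (run t ans) * \<rho> ^ m)
            \<le> wt b s * (wt b (run t ans) * (exp (\<mu> * cost t ans) * \<rho> ^ m))"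
          using assms(2,3) wt_pos[of b "run t ans"] wt_pos[of b s]
            mult_right_mono[of 1 "exp (\<mu> * cost t ans)" "\<rho> ^ m"]
          by (intro mult_left_mono) auto
        then show "wt b (s + run t ans) * (exp (\<mu> * (real (c + cost t ans) - real B)) + \<rho> ^ m)
            \<le> wt b s * (e + \<rho> ^ m) * pay \<mu> t b ans"
          unfolding * wt_add pay_def
          by (simp add: algebra_simps)
      qed auto
      also have "\<dots> = wt b s * (e + \<rho> ^ m) * measure_pmf.expectation P (\<lambda>t. pay \<mu> t b ans)"
        by (simp add: E sum_distrib_left algebra_simps)
      also have "\<dots> \<le> wt b s * (e + \<rho> ^ m) * \<rho>"
        using assms(3,5) wt_pos[of b s] by (intro mult_left_mono) (auto simp: e_def)
      also have "\<dots> \<le> wt b s * (e + \<rho> ^ Suc m)"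
        using assms(3,4) wt_pos[of b s]
        by (simp add: algebra_simps mult_left_le mult_left_mono e_def)
      finally show ?thesis by (simp add: e_def)
    qed
  }
qed

lemma R_err_leI:
  assumes "\<And>t. t \<in> set_pmf P \<Longrightarrow> queries t \<subseteq> {..<n} \<and> depth t \<le> d"
    and "\<And>b x. x \<in> fibre n f b \<Longrightarrow> measure_pmf.prob P {t. run t (\<lambda>i. x ! i) = b} \<ge> 1 - \<epsilon>"
  shows "R_err \<epsilon> n f \<le> d"
  unfolding R_err_def using assms by (intro Least_le exI[of _ P]) blast

lemma finite_fibre: "finite (fibre n f b)"
  unfolding fibre_def
  by (rule finite_subset[OF _ finite_lists_length_eq[of "UNIV :: bool set" n]]) auto

text \<open>On the finite domain the expected payoffs have a maximum \<open>\<rho> < 1\<close>, so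
  some \<open>m\<close> makes \<open>\<rho> ^ m\<close> fit between \<open>exp (- \<mu> * B)\<close>
  and \<open>1 / 3\<close>. The vote among \<open>m\<close> independent trees has depth at most
  \<open>B + d\<close> whatever \<open>m\<close> is.\<close>

lemma R_le_of_forecast:
  assumes "finite (set_pmf P)" "\<mu> \<ge> 0" "exp (- \<mu> * B) < 1 / 3"
    and "\<And>t. t \<in> set_pmf P \<Longrightarrow> queries t \<subseteq> {..<n} \<and> depth t \<le> d"
    and "\<And>b x. x \<in> fibre n f b \<Longrightarrow> measure_pmf.expectation P (\<lambda>t. pay \<mu> t b (\<lambda>i. x ! i)) < 1"
  shows "R n f \<le> B + d"
proof -
  \<comment> \<open>Inserting \<open>0\<close> makes the set nonempty and its maximum
    nonnegative.\<close>
  define V where "V = insert 0 ((\<lambda>(b, x). measure_pmf.expectation P (\<lambda>t. pay \<mu> t b (\<lambda>i. x ! i))) ` Sigma UNIV (fibre n f))"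
  define \<rho> where "\<rho> = Max V"
  have V: "finite V" "V \<noteq> {}" unfolding V_def using finite_fibre by auto
  have \<rho>: "0 \<le> \<rho>" "\<rho> < 1" 
    using V assms(5) by (auto simp: \<rho>_def V_def)
  have \<rho>_ge: "measure_pmf.expectation P (\<lambda>t. pay \<mu> t b (\<lambda>i. x ! i)) \<le> \<rho>" if "x \<in> fibre n f b" for b x
    unfolding \<rho>_def using V(1) that by (intro Max_ge) (auto simp: V_def)
  have "(\<lambda>m. \<rho> ^ m) \<longlonglongrightarrow> 0" using \<rho> by (intro LIMSEQ_realpow_zero) auto
  then have "eventually (\<lambda>m. \<rho> ^ m < 1 / 3 - exp (- \<mu> * B)) sequentially"
    using assms(3) by (intro order_tendstoD) auto
  then obtain m where m: "\<rho> ^ m < 1 / 3 - exp (- \<mu> * B)"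
    by (auto simp: eventually_sequentially)
  let ?T = "map_pmf (\<lambda>ts. vote B ts 0 0) (replicate_pmf m P)"
  show ?thesis
  proof (rule R_err_leI[where P = ?T])
    fix t assume "t \<in> set_pmf ?T"
    then obtain ts where "set ts \<subseteq> set_pmf P" "t = vote B ts 0 0"
      by (auto simp: set_replicate_pmf)
    then show "queries t \<subseteq> {..<n} \<and> depth t \<le> B + d"
      using queries_vote[of ts "{..<n}" B 0 0] depth_vote[of ts d 0 B 0] assms(4) by auto
  next
    fix b x assume x: "x \<in> fibre n f b"
    have "wt b 0 = 1" by (simp add: wt_def)
    have "measure_pmf.prob ?T {t. run t (\<lambda>i. x ! i) = b}
        = 1 - measure_pmf.prob (replicate_pmf m P) {ts. run (vote B ts 0 0) (\<lambda>i. x ! i) \<noteq> b}"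
      by (subst measure_pmf.prob_compl[symmetric])
         (auto simp: vimage_def intro!: arg_cong[where f="measure _"])
    moreover have "measure_pmf.prob (replicate_pmf m P) {ts. run (vote B ts 0 0) (\<lambda>i. x ! i) \<noteq> b}
        \<le> wt b 0 * (exp (\<mu> * (real 0 - real B)) + \<rho> ^ m)"
      using assms \<rho> \<rho>_ge[OF x] by (intro vote_error) auto
    ultimately show "1 - 1 / 3 \<le> measure_pmf.prob ?T {t. run t (\<lambda>i. x ! i) = b}"
      using m unfolding \<open>wt b 0 = 1\<close> by simp
  qed
qed

section \<open>Subadditivity of the squared Hellinger distance\<close>

lemma sum_two_points:
  fixes x y z :: real
  assumes "s < N" "t < N" "s \<noteq> t"
  shows "(\<Sum>c<N. if c = s then x else if c = t then y else z) = x + y + (real N - 2) * z"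
proof -
  have "(\<Sum>c<N. if c = s then x else if c = t then y else z)
      = (\<Sum>c<N. (if c = s then x - z else 0) + (if c = t then y - z else 0) + z)"
    using assms by (intro sum.cong) auto
  also have "\<dots> = x + y + (real N - 2) * z"
    using assms by (simp add: sum.distrib sum.delta' algebra_simps)
  finally show ?thesis .
qed

lemma sum_one_point:
  fixes x z :: real
  assumes "s < N"
  shows "(\<Sum>c<N. if c = s then x else z) = x + (real N - 1) * z"
proof -
  have "(\<Sum>c<N. if c = s then x else z) = (\<Sum>c<N. (if c = s then x - z else 0) + z)"
    using assms by (intro sum.cong) auto
  also have "\<dots> = x + (real N - 1) * z"
    using assms by (simp add: sum.distrib sum.delta' algebra_simps)
  finally show ?thesis .
qed

text \<open>Each coordinate gets one of \<open>N\<close> colours; \<open>A s k\<close> takes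
  \<open>b\<close> on the coordinates of colour \<open>s\<close> and \<open>a\<close> elsewhere. The
  claim is the nonnegativity of the squares of \<open>(\<Sum>s<N. A s k) - N * A0\<close>, summed
  over all colourings \<open>k\<close>: products of two distinct colours average to
  \<open>F (2 / N)\<close>, products of a colour with \<open>A0\<close> to
  \<open>F (1 / N)\<close>.\<close>

lemma colouring_square:
  fixes a b :: "'i \<Rightarrow> real" and N :: nat and F :: "real \<Rightarrow> real"
  assumes I: "finite I" and N: "N \<ge> 1"
  defines "F \<equiv> \<lambda>p :: real. \<Prod>i\<in>I. (1 - p) * (a i)\<^sup>2 + p * (a i * b i)"
  shows "2 * N\<^sup>2 * F (1 / N)
    \<le> N * (\<Prod>i\<in>I. (1 - 1 / N) * (a i)\<^sup>2 + 1 / N * (b i)\<^sup>2) + N * (real N - 1) * F (2 / N) + N\<^sup>2 * F 0"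
proof -
  define K where "K = PiE I (\<lambda>_. {..<N})"
  define A :: "nat \<Rightarrow> ('i \<Rightarrow> nat) \<Rightarrow> real" where "A = (\<lambda>s k. \<Prod>i\<in>I. if k i = s then b i else a i)"
  define A0 where "A0 = (\<Prod>i\<in>I. a i)"
  define M where "M = real N ^ card I"
  define X where "X = (\<Prod>i\<in>I. (1 - 1 / N) * (a i)\<^sup>2 + 1 / N * (b i)\<^sup>2)"
  have fK: "finite K" unfolding K_def using I by (intro finite_PiE) auto
  have scale: "(\<Prod>i\<in>I. h i) = M * (\<Prod>i\<in>I. h' i)" if "\<And>i. i \<in> I \<Longrightarrow> h i = N * h' i" for h h' :: "'i \<Rightarrow> real"
    using that by (simp add: M_def prod.distrib)
  have K_prod: "(\<Sum>k\<in>K. \<Prod>i\<in>I. g i (k i)) = (\<Prod>i\<in>I. \<Sum>c<N. g i c)" for g :: "'i \<Rightarrow> nat \<Rightarrow> real"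
    unfolding K_def using I by (intro prod_sum_PiE[symmetric]) auto
  have same: "(\<Sum>k\<in>K. A s k * A s k) = M * X" if "s < N" for s
  proof -
    have "(\<Sum>k\<in>K. A s k * A s k) = (\<Sum>k\<in>K. \<Prod>i\<in>I. if k i = s then (b i)\<^sup>2 else (a i)\<^sup>2)"
      unfolding A_def prod.distrib[symmetric]
      by (intro sum.cong prod.cong refl) (auto simp: power2_eq_square)
    also have "\<dots> = (\<Prod>i\<in>I. (b i)\<^sup>2 + (real N - 1) * (a i)\<^sup>2)"
      using that by (subst K_prod) (simp add: sum_one_point)
    also have "\<dots> = M * X"
      unfolding X_def using N by (intro scale) (simp add: field_simps)
    finally show ?thesis .
  qed
  have diff: "(\<Sum>k\<in>K. A s k * A t k) = M * F (2 / N)" if "s < N" "t < N" "s \<noteq> t" for s t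
  proof -
    have "(\<Sum>k\<in>K. A s k * A t k)
        = (\<Sum>k\<in>K. \<Prod>i\<in>I. if k i = s then a i * b i else if k i = t then a i * b i else (a i)\<^sup>2)"
      unfolding A_def prod.distrib[symmetric]
      by (intro sum.cong prod.cong refl) (use that in \<open>auto simp: power2_eq_square\<close>)
    also have "\<dots> = (\<Prod>i\<in>I. a i * b i + a i * b i + (real N - 2) * (a i)\<^sup>2)"
      using that by (subst K_prod) (simp add: sum_two_points)
    also have "\<dots> = M * F (2 / N)"
      unfolding F_def using N by (intro scale) (simp add: field_simps)
    finally show ?thesis .
  qed
  have centre: "(\<Sum>k\<in>K. A0 * A s k) = M * F (1 / N)" if "s < N" for s
  proof -
    have "(\<Sum>k\<in>K. A0 * A s k) = (\<Sum>k\<in>K. \<Prod>i\<in>I. if k i = s then a i * b i else (a i)\<^sup>2)"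
      unfolding A_def A0_def prod.distrib[symmetric]
      by (intro sum.cong prod.cong refl) (use that in \<open>auto simp: power2_eq_square\<close>)
    also have "\<dots> = (\<Prod>i\<in>I. a i * b i + (real N - 1) * (a i)\<^sup>2)"
      using that by (subst K_prod) (simp add: sum_one_point)
    also have "\<dots> = M * F (1 / N)"
      unfolding F_def using N by (intro scale) (simp add: field_simps)
    finally show ?thesis .
  qed
  have zero: "(\<Sum>k\<in>K. A0 * A0) = M * F 0"
  proof -
    have "real (card K) = M" using I by (simp add: K_def card_PiE M_def)
    then show ?thesis by (simp add: A0_def F_def power2_eq_square flip: prod.distrib)
  qed
  have pairs: "(\<Sum>s<N. \<Sum>t<N. \<Sum>k\<in>K. A s k * A t k) = N * (M * X) + N * (real N - 1) * (M * F (2 / N))"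
  proof -
    have "(\<Sum>s<N. \<Sum>t<N. \<Sum>k\<in>K. A s k * A t k) = (\<Sum>s<N. \<Sum>t<N. if t = s then M * X else M * F (2 / N))"
      by (intro sum.cong refl) (use same diff in auto)
    also have "\<dots> = N * (M * X) + N * (real N - 1) * (M * F (2 / N))"
      by (simp add: sum_one_point algebra_simps)
    finally show ?thesis .
  qed
  have "0 \<le> (\<Sum>k\<in>K. ((\<Sum>s<N. A s k) - N * A0)\<^sup>2)"
    by (intro sum_nonneg) auto
  also have "\<dots> = (\<Sum>k\<in>K. (\<Sum>s<N. \<Sum>t<N. A s k * A t k) - 2 * N * (\<Sum>s<N. A0 * A s k) + N\<^sup>2 * (A0 * A0))"
    by (intro sum.cong refl)
       (simp add: power2_diff power2_eq_square sum_product sum_distrib_left algebra_simps)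
  also have "\<dots> = (\<Sum>k\<in>K. \<Sum>s<N. \<Sum>t<N. A s k * A t k) - 2 * N * (\<Sum>k\<in>K. \<Sum>s<N. A0 * A s k)
      + N\<^sup>2 * (\<Sum>k\<in>K. A0 * A0)"
    by (simp only: sum.distrib sum_subtractf sum_distrib_left)
  also have "(\<Sum>k\<in>K. \<Sum>s<N. \<Sum>t<N. A s k * A t k) = (\<Sum>s<N. \<Sum>t<N. \<Sum>k\<in>K. A s k * A t k)"
    by (subst sum.swap, intro sum.cong refl, subst sum.swap) simp
  also have "(\<Sum>k\<in>K. \<Sum>s<N. A0 * A s k) = (\<Sum>s<N. \<Sum>k\<in>K. A0 * A s k)"
    by (rule sum.swap)
  also have "\<dots> = N * (M * F (1 / N))"
    by (simp add: centre)
  finally have "0 \<le> M * (N * X + N * (real N - 1) * F (2 / N) - 2 * N\<^sup>2 * F (1 / N) + N\<^sup>2 * F 0)"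
    unfolding pairs zero by (simp add: algebra_simps power2_eq_square)
  moreover have "M > 0" using N by (simp add: M_def)
  ultimately show ?thesis
    unfolding X_def[symmetric] by (simp add: zero_le_mult_iff)
qed

text \<open>
  With \<open>G p\<close> the squared Hellinger distance between the unperturbed distribution and the one with each
  coordinate independently flipped with probability \<open>p\<close>, the previous lemma gives
  \<open>(1 - p) * G (2 * p) \<le> 2 * G p\<close> for \<open>p = 2\<^sup>-\<^sup>j\<close>; iterate down to the derivative at \<open>0\<close>.
\<close>

lemma hellinger_subadditive:
  fixes a b :: "'i \<Rightarrow> 'v \<Rightarrow> real"
  assumes I: "finite I"
    and mix: "\<And>p. 0 \<le> p \<Longrightarrow> p \<le> 1 \<Longrightarrow> (\<Sum>v\<in>V. \<Prod>i\<in>I. (1 - p) * (a i v)\<^sup>2 + p * (b i v)\<^sup>2) = 1"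
  shows "1 - (\<Sum>v\<in>V. \<Prod>i\<in>I. a i v * b i v)
    \<le> 4 * (\<Sum>i\<in>I. 1 - (\<Sum>v\<in>V. a i v * b i v * (\<Prod>j\<in>I - {i}. (a j v)\<^sup>2)))"
proof -
  define F where "F = (\<lambda>p :: real. \<Sum>v\<in>V. \<Prod>i\<in>I. (1 - p) * (a i v)\<^sup>2 + p * (a i v * b i v))"
  define G where "G = (\<lambda>p. 1 - F p)"
  define H where "H = (\<Sum>i\<in>I. 1 - (\<Sum>v\<in>V. a i v * b i v * (\<Prod>j\<in>I - {i}. (a j v)\<^sup>2)))"
  have F0: "F 0 = 1" using mix[of 0] by (simp add: F_def)
  have halve: "(1 - 1 / N) * G (2 / N) \<le> 2 * G (1 / N)" if N: "N \<ge> 1" for N :: nat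
  proof -
    have "2 * N\<^sup>2 * F (1 / N) = (\<Sum>v\<in>V. 2 * N\<^sup>2 * (\<Prod>i\<in>I. (1 - 1 / N) * (a i v)\<^sup>2 + 1 / N * (a i v * b i v)))"
      by (simp add: F_def sum_distrib_left)
    also have "\<dots> \<le> (\<Sum>v\<in>V. N * (\<Prod>i\<in>I. (1 - 1 / N) * (a i v)\<^sup>2 + 1 / N * (b i v)\<^sup>2)
        + N * (real N - 1) * (\<Prod>i\<in>I. (1 - 2 / N) * (a i v)\<^sup>2 + 2 / N * (a i v * b i v))
        + N\<^sup>2 * (\<Prod>i\<in>I. (1 - 0) * (a i v)\<^sup>2 + 0 * (a i v * b i v)))"
      by (intro sum_mono colouring_square I N)
    also have "\<dots> = N * 1 + N * (real N - 1) * F (2 / N) + N\<^sup>2 * F 0"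
      unfolding F_def mix[of "1 / N", symmetric, simplified]
      using mix[of "1 / N"] N by (simp only: sum.distrib sum_distrib_left[symmetric]) simp
    finally have "real N * (2 * N * F (1 / N)) \<le> real N * (1 + (real N - 1) * F (2 / N) + N)"
      by (simp add: F0 power2_eq_square algebra_simps)
    then have "2 * N * F (1 / N) \<le> 1 + (real N - 1) * F (2 / N) + N"
      using N by (subst (asm) mult_le_cancel_left_pos) auto
    then show ?thesis using N by (simp add: G_def field_simps)
  qed
  \<comment> \<open>The factor \<open>1 + 2 / 2 ^ j\<close> absorbs the losses
    \<open>1 - 1 / N\<close> of \<open>halve\<close>: for \<open>e = 1 / 2 ^ j\<close> at most
    \<open>1 / 2\<close>, \<open>(1 + 2 * e) * (1 - e / 2) \<ge> 1 + e\<close>. It is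
    \<open>2\<close> at \<open>j = 1\<close> and never drops below \<open>1\<close>.\<close>
  have iter: "(1 / 4) * (1 + 2 / 2 ^ j) * G 1 \<le> 2 ^ j * G (1 / 2 ^ j)" if "G 1 \<ge> 0" "j \<ge> 1" for j
    using that(2)
  proof (induction j rule: dec_induct)
    case base
    have "(1 - 1 / real 2) * G (2 / real 2) \<le> 2 * G (1 / real 2)" by (rule halve) simp
    then show ?case by simp
  next
    case (step j)
    define e :: real where "e = 1 / 2 ^ j"
    have e: "0 < e" "e \<le> 1 / 2"
      using step.hyps power_increasing[of 1 j "2 :: real"] by (auto simp: e_def field_simps)
    have "(1 / 4) * (1 + e) \<le> (1 / 4) * (1 + 2 * e) * (1 - e / 2)"
      using mult_left_mono[OF e(2) less_imp_le[OF e(1)]] by (simp add: field_simps)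
    then have "(1 / 4) * (1 + e) * G 1 \<le> (1 / 4) * (1 + 2 * e) * (1 - e / 2) * G 1"
      using \<open>G 1 \<ge> 0\<close> by (intro mult_right_mono) auto
    also have "\<dots> = (1 - e / 2) * ((1 / 4) * (1 + 2 / 2 ^ j) * G 1)" by (simp add: e_def)
    also have "\<dots> \<le> (1 - e / 2) * (2 ^ j * G e)"
      using step.IH e by (intro mult_left_mono) (auto simp: e_def)
    also have "\<dots> = 2 ^ j * ((1 - 1 / real (2 ^ Suc j)) * G (2 / real (2 ^ Suc j)))"
      by (simp add: e_def)
    also have "\<dots> \<le> 2 ^ j * (2 * G (1 / real (2 ^ Suc j)))"
      by (intro mult_left_mono halve) auto
    finally show ?case by (simp add: e_def)
  qed
  \<comment> \<open>By the product rule the derivative at \<open>0\<close> changes one coordinate at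
    a time, which gives minus the sum of the single-coordinate distances.\<close>
  have deriv: "(F has_field_derivative - H) (at 0)"
  proof -
    have "(F has_field_derivative
        (\<Sum>v\<in>V. \<Sum>i\<in>I. (a i v * b i v - (a i v)\<^sup>2) * (\<Prod>j\<in>I - {i}. (1 - 0) * (a j v)\<^sup>2 + 0 * (a j v * b j v)))) (at 0)"
      unfolding F_def
      by (intro DERIV_sum has_field_derivative_prod) (auto intro!: derivative_eq_intros)
    moreover have "(\<Sum>v\<in>V. \<Sum>i\<in>I. (a i v * b i v - (a i v)\<^sup>2) * (\<Prod>j\<in>I - {i}. (a j v)\<^sup>2))
        = (\<Sum>i\<in>I. (\<Sum>v\<in>V. a i v * b i v * (\<Prod>j\<in>I - {i}. (a j v)\<^sup>2)) - (\<Sum>v\<in>V. \<Prod>j\<in>I. (a j v)\<^sup>2))"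
    proof -
      have "(a i v)\<^sup>2 * (\<Prod>j\<in>I - {i}. (a j v)\<^sup>2) = (\<Prod>j\<in>I. (a j v)\<^sup>2)" if "i \<in> I" for i v
        using I that by (rule prod.remove[symmetric])
      then have "(\<Sum>v\<in>V. (a i v)\<^sup>2 * (\<Prod>j\<in>I - {i}. (a j v)\<^sup>2)) = (\<Sum>v\<in>V. \<Prod>j\<in>I. (a j v)\<^sup>2)" if "i \<in> I" for i
        using that by simp
      then show ?thesis
        by (subst sum.swap) (simp add: left_diff_distrib sum_subtractf)
    qed
    moreover have "(\<Sum>v\<in>V. \<Prod>j\<in>I. (a j v)\<^sup>2) = 1" using mix[of 0] by simp
    ultimately show ?thesis by (simp add: H_def sum_subtractf)
  qed
  have "((\<lambda>h. (F (0 + h) - F 0) / h) \<longlongrightarrow> - H) (at 0)"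
    using deriv by (simp add: DERIV_def)
  then have "((\<lambda>h. G h / h) \<longlongrightarrow> H) (at 0)"
    using tendsto_minus[of "\<lambda>h. (F (0 + h) - F 0) / h" "- H" "at 0"]
    by (simp add: F0 G_def minus_divide_left)
  moreover have "filterlim (\<lambda>j. 1 / 2 ^ j :: real) (at 0) sequentially"
    unfolding filterlim_at using LIMSEQ_realpow_zero[of "1 / 2 :: real"] by (auto simp: power_divide)
  ultimately have "(\<lambda>j. G (1 / 2 ^ j) / (1 / 2 ^ j)) \<longlonglongrightarrow> H"
    by (rule filterlim_compose)
  then have lim: "(\<lambda>j. 2 ^ j * G (1 / 2 ^ j)) \<longlonglongrightarrow> H" by (simp add: mult.commute)
  have "G 1 \<le> 4 * H" if "G 1 \<ge> 0"
  proof -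
    have "(1 / 4) * G 1 \<le> 2 ^ j * G (1 / 2 ^ j)" if "j \<ge> 1" for j
    proof -
      have "(1 / 4) * 1 * G 1 \<le> (1 / 4) * (1 + 2 / 2 ^ j) * G 1"
        using \<open>G 1 \<ge> 0\<close> by (intro mult_right_mono mult_left_mono) auto
      with iter[OF \<open>G 1 \<ge> 0\<close> that] show ?thesis by simp
    qed
    then have "(1 / 4) * G 1 \<le> H" by (intro LIMSEQ_le_const[OF lim]) auto
    then show ?thesis by simp
  qed
  \<comment> \<open>Arithmetic-geometric mean inequality for the two products at each
    \<open>v\<close>.\<close>
  moreover have "G 1 \<ge> 0"
  proof -
    have "F 1 \<le> (\<Sum>v\<in>V. ((\<Prod>i\<in>I. (a i v)\<^sup>2) + (\<Prod>i\<in>I. (b i v)\<^sup>2)) / 2)"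
      unfolding F_def
    proof (intro sum_mono)
      fix v
      show "(\<Prod>i\<in>I. (1 - 1) * (a i v)\<^sup>2 + 1 * (a i v * b i v))
          \<le> ((\<Prod>i\<in>I. (a i v)\<^sup>2) + (\<Prod>i\<in>I. (b i v)\<^sup>2)) / 2"
        using sum_squares_bound[of "\<Prod>i\<in>I. a i v" "\<Prod>i\<in>I. b i v"]
        by (simp add: prod.distrib prod_power_distrib)
    qed
    also have "\<dots> = 1"
      using mix[of 0] mix[of 1] by (simp add: sum.distrib flip: sum_divide_distrib)
    finally show ?thesis by (simp add: G_def)
  qed
  ultimately show ?thesis by (simp add: G_def F_def H_def)
qed

section \<open>Transcripts\<close>

text \<open>A path may answer a repeated query inconsistently; no input agrees with such a path, so
  it gets probability \<open>0\<close>.\<close>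

primrec paths :: "('q, 'o) dtree \<Rightarrow> (('q \<times> bool) list \<times> 'o) set" where
  "paths (Leaf v) = {([], v)}"
| "paths (Query q l r) = apfst (Cons (q, False)) ` paths l \<union> apfst (Cons (q, True)) ` paths r"

lemma finite_paths: "finite (paths t)"
  by (induction t) auto

lemma sum_paths_Query:
  fixes l r :: "('q, 'o) dtree"
  shows "(\<Sum>p\<in>paths (Query q l r). F p)
    = (\<Sum>p\<in>paths l. F (apfst (Cons (q, False)) p)) + (\<Sum>p\<in>paths r. F (apfst (Cons (q, True)) p))"
proof -
  have "sum F (apfst (Cons e) ` A) = (\<Sum>p\<in>A. F (apfst (Cons e) p))" for e and A :: "(('q \<times> bool) list \<times> 'o) set"
    by (subst sum.reindex) (auto simp: inj_on_def)
  then show ?thesis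
    by (simp, subst sum.union_disjoint) (auto simp: finite_paths)
qed

lemma length_path_le_depth: "p \<in> paths t \<Longrightarrow> length (fst p) \<le> depth t"
  by (induction t arbitrary: p) fastforce+

section \<open>Events and query counts of a single sample\<close>

definition agrees :: "((nat \<times> nat) \<times> bool) list \<Rightarrow> nat \<Rightarrow> bool list \<Rightarrow> bool" where
  "agrees v i x \<longleftrightarrow> (\<forall>((i', j), a)\<in>set v. i' = i \<longrightarrow> x ! j = a)"

definition reads :: "((nat \<times> nat) \<times> bool) list \<Rightarrow> nat \<Rightarrow> nat" where
  "reads v i = length (filter (\<lambda>e. fst (fst e) = i) v)"

lemma agrees_simps [simp]:
  "agrees [] i x"
  "agrees (((i', j), a) # v) i x \<longleftrightarrow> (i' = i \<longrightarrow> x ! j = a) \<and> agrees v i x"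
  by (auto simp: agrees_def)

lemma reads_simps [simp]:
  "reads [] i = 0"
  "reads (((i', j), a) # v) i = (if i' = i then Suc (reads v i) else reads v i)"
  by (auto simp: reads_def)

lemma sum_reads_le: "finite I \<Longrightarrow> (\<Sum>i\<in>I. reads v i) \<le> length v"
proof (induction v)
  case Nil
  then show ?case by simp
next
  case (Cons e v)
  obtain i' j a where e: "e = ((i', j), a)" by (metis prod.exhaust)
  have "(\<Sum>i\<in>I. reads (e # v) i) = (\<Sum>i\<in>I. (if i = i' then 1 else 0) + reads v i)"
    by (intro sum.cong) (auto simp: e)
  also have "\<dots> \<le> 1 + (\<Sum>i\<in>I. reads v i)"
    using Cons.prems by (simp add: sum.distrib sum.delta)
  finally show ?case using Cons by simp
qed

text \<open>A query to sample \<open>i0\<close> splits the factor of \<open>i0\<close> by additivity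
  and leaves the others alone. Stated for additive \<open>s i\<close>, the lemma covers mixtures and
  products with different factors; \<open>A\<close> accumulates the answers already given.\<close>

lemma sum_paths_product:
  fixes s :: "nat \<Rightarrow> (bool list \<Rightarrow> bool) \<Rightarrow> real"
  assumes additive: "\<And>i A B. i < k \<Longrightarrow> s i A = s i (\<lambda>x. A x \<and> B x) + s i (\<lambda>x. A x \<and> \<not> B x)"
    and "queries t \<subseteq> {..<k} \<times> Q"
  shows "(\<Sum>p\<in>paths t. \<Prod>i<k. s i (\<lambda>x. A i x \<and> agrees (fst p) i x)) = (\<Prod>i<k. s i (A i))"
  using assms(2)
proof (induction t arbitrary: A)
  case (Leaf v)
  then show ?case by simp
next
  case (Query q l r)
  obtain i0 j where q: "q = (i0, j)" by (cases q)
  have i0: "i0 < k" using Query.prems q by auto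
  have branch: "(\<Prod>i<k. s i (\<lambda>x. A i x \<and> (i0 = i \<longrightarrow> x ! j = a)))
      = s i0 (\<lambda>x. A i0 x \<and> x ! j = a) * (\<Prod>i\<in>{..<k} - {i0}. s i (A i))" for a
    using i0 by (subst prod.remove[of _ i0]) (auto intro!: prod.cong arg_cong[where f="s _"])
  have "(\<Sum>p\<in>paths (Query q l r). \<Prod>i<k. s i (\<lambda>x. A i x \<and> agrees (fst p) i x))
      = (\<Prod>i<k. s i (\<lambda>x. A i x \<and> (i0 = i \<longrightarrow> x ! j = False)))
      + (\<Prod>i<k. s i (\<lambda>x. A i x \<and> (i0 = i \<longrightarrow> x ! j = True)))"
    using Query.IH(1)[of "\<lambda>i x. A i x \<and> (i0 = i \<longrightarrow> x ! j = False)"]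
      Query.IH(2)[of "\<lambda>i x. A i x \<and> (i0 = i \<longrightarrow> x ! j = True)"] Query.prems
    by (simp only: sum_paths_Query) (simp add: q conj_assoc cong: if_cong)
  also have "\<dots> = s i0 (A i0) * (\<Prod>i\<in>{..<k} - {i0}. s i (A i))"
    unfolding branch using additive[OF i0, of "A i0" "\<lambda>x. x ! j"] by (simp add: algebra_simps)
  also have "\<dots> = (\<Prod>i<k. s i (A i))"
    using i0 by (intro prod.remove[symmetric]) auto
  finally show ?case .
qed

lemma prob_split:
  "measure_pmf.prob M {x. A x} = measure_pmf.prob M {x. A x \<and> B x} + measure_pmf.prob M {x. A x \<and> \<not> B x}"
  by (subst measure_pmf.finite_measure_Union[symmetric])
     (auto intro!: arg_cong[where f="measure _"])

lemma prob_replicate_pmf: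
  "measure_pmf.prob (replicate_pmf k M) {xs. \<forall>i<k. A i (xs ! i)} = (\<Prod>i<k. measure_pmf.prob M {x. A i x})"
proof (induction k arbitrary: A)
  case 0
  then show ?case by simp
next
  case (Suc k)
  have "measure_pmf.prob (replicate_pmf (Suc k) M) {xs. \<forall>i<Suc k. A i (xs ! i)}
      = measure_pmf.expectation M (\<lambda>x. measure_pmf.prob (replicate_pmf k M)
          {xs. A 0 x \<and> (\<forall>i<k. A (Suc i) (xs ! i))})"
    by (simp add: measure_bind_pmf map_pmf_def[symmetric] vimage_def All_less_Suc2)
  also have "\<dots> = measure_pmf.expectation M (\<lambda>x. indicator {x. A 0 x} x *
      measure_pmf.prob (replicate_pmf k M) {xs. \<forall>i<k. A (Suc i) (xs ! i)})"
    by (intro Bochner_Integration.integral_cong) (auto simp: indicator_def)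
  also have "\<dots> = measure_pmf.prob M {x. A 0 x} * (\<Prod>i<k. measure_pmf.prob M {x. A (Suc i) x})"
    by (simp add: Suc.IH[of "\<lambda>i. A (Suc i)"])
  finally show ?case by (simp add: prod.lessThan_Suc_shift del: prod.lessThan_Suc)
qed

text \<open>The paths partition the inputs, and independence of the samples makes the probability of
  each path a product. \<open>A\<close> again accumulates the answers.\<close>

lemma prob_run_replicate_pmf:
  assumes "queries t \<subseteq> {..<k} \<times> Q"
  shows "measure_pmf.prob (replicate_pmf k M) {xs. (\<forall>i<k. A i (xs ! i)) \<and> run t (\<lambda>(i, j). xs ! i ! j) = u}
    = (\<Sum>p\<in>paths t. if snd p = u then \<Prod>i<k. measure_pmf.prob M {x. A i x \<and> agrees (fst p) i x} else 0)"
  using assms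
proof (induction t arbitrary: A)
  case (Leaf v)
  then show ?case by (cases "v = u") (simp_all add: prob_replicate_pmf)
next
  case (Query q l r)
  obtain i0 j where q: "q = (i0, j)" by (cases q)
  have i0: "i0 < k" using Query.prems q by auto
  let ?rd = "\<lambda>(xs :: bool list list) (i, j). xs ! i ! j"
  have "measure_pmf.prob (replicate_pmf k M) {xs. (\<forall>i<k. A i (xs ! i)) \<and> run (Query q l r) (?rd xs) = u}
    = measure_pmf.prob (replicate_pmf k M)
        {xs. (\<forall>i<k. A i (xs ! i) \<and> (i0 = i \<longrightarrow> xs ! i ! j = False)) \<and> run l (?rd xs) = u}
    + measure_pmf.prob (replicate_pmf k M)
        {xs. (\<forall>i<k. A i (xs ! i) \<and> (i0 = i \<longrightarrow> xs ! i ! j = True)) \<and> run r (?rd xs) = u}"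
    using i0
    by (subst prob_split[of _ _ "\<lambda>xs. \<not> xs ! i0 ! j"])
       (auto simp: q intro!: arg_cong2[where f="(+)"] arg_cong[where f="measure _"])
  also have "\<dots> = (\<Sum>p\<in>paths (Query q l r). if snd p = u
      then \<Prod>i<k. measure_pmf.prob M {x. A i x \<and> agrees (fst p) i x} else 0)"
    using Query.IH(1)[of "\<lambda>i x. A i x \<and> (i0 = i \<longrightarrow> x ! j = False)"]
      Query.IH(2)[of "\<lambda>i x. A i x \<and> (i0 = i \<longrightarrow> x ! j = True)"] Query.prems
    by (simp only: sum_paths_Query) (simp add: q conj_assoc cong: if_cong)
  finally show ?case .
qed

text \<open>
  The samples other than the \<open>i\<close>-th could be drawn at random; instead each query to one of them is
  answered by the branch with the smaller payoff, which keeps the resulting tree deterministic.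
\<close>

lemma restrict_to_sample:
  fixes s :: "nat \<Rightarrow> (bool list \<Rightarrow> bool) \<Rightarrow> real" and m :: "bool list \<Rightarrow> real" 
    and \<phi> :: "((nat \<times> nat) \<times> bool) list \<times> 'b \<Rightarrow> real"
  assumes additive: "\<And>j A B. j < k \<Longrightarrow> s j A = s j (\<lambda>x. A x \<and> B x) + s j (\<lambda>x. A x \<and> \<not> B x)"
    and nonneg: "\<And>j A. j < k \<Longrightarrow> s j A \<ge> 0"
    and "queries T \<subseteq> {..<k} \<times> Q" "finite X" "i < k"
  shows "\<exists>t. queries t \<subseteq> Q \<and> depth t \<le> depth T \<and>
    (\<Prod>j\<in>{..<k} - {i}. s j (A j)) * (\<Sum>x\<in>{x\<in>X. A i x}. m x * pay \<mu> t (b x) (\<lambda>j. x ! j))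
    \<le> (\<Sum>p\<in>paths T. (\<Prod>j\<in>{..<k} - {i}. s j (\<lambda>x. A j x \<and> agrees (fst p) j x)) *
         (exp (\<mu> * reads (fst p) i) * (\<Sum>x\<in>{x\<in>X. A i x \<and> agrees (fst p) i x}. m x * wt (b x) (\<phi> p))))"
  using assms(3)
proof (induction T arbitrary: A \<phi>)
  case (Leaf v)
  then show ?case
    by (intro exI[of _ "Leaf (\<phi> ([], v))"]) (simp add: pay_def)
next
  case (Query q l r)
  obtain i0 j where q: "q = (i0, j)" by (cases q)
  have i0: "i0 < k" and j: "j \<in> Q" using Query.prems q by auto
  let ?A = "\<lambda>a i x. A i x \<and> (i0 = i \<longrightarrow> x ! j = a)"
  let ?pr = "\<lambda>A. \<Prod>j\<in>{..<k} - {i}. s j (A j)"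
  let ?pay = "\<lambda>A t. \<Sum>x\<in>{x\<in>X. A i x}. m x * pay \<mu> t (b x) (\<lambda>j. x ! j)"
  let ?rhs = "\<lambda>\<phi> T A c. \<Sum>p\<in>paths T. ?pr (\<lambda>j x. A j x \<and> agrees (fst p) j x) *
         (exp (\<mu> * c (reads (fst p) i)) * (\<Sum>x\<in>{x\<in>X. A i x \<and> agrees (fst p) i x}. m x * wt (b x) (\<phi> p)))"
  \<comment> \<open>\<open>c\<close> adds the read made by the root query if it concerns sample
    \<open>i\<close>.\<close>
  define c where "c = (\<lambda>n. if i0 = i then Suc n else n)"
  obtain tl where tl: "queries tl \<subseteq> Q" "depth tl \<le> depth l"
    "?pr (?A False) * ?pay (?A False) tl \<le> ?rhs (\<lambda>p. \<phi> (apfst (Cons (q, False)) p)) l (?A False) (\<lambda>n. n)"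
    using Query.IH(1)[of "?A False" "\<lambda>p. \<phi> (apfst (Cons (q, False)) p)"] Query.prems by auto
  obtain tr where tr: "queries tr \<subseteq> Q" "depth tr \<le> depth r"
    "?pr (?A True) * ?pay (?A True) tr \<le> ?rhs (\<lambda>p. \<phi> (apfst (Cons (q, True)) p)) r (?A True) (\<lambda>n. n)"
    using Query.IH(2)[of "?A True" "\<lambda>p. \<phi> (apfst (Cons (q, True)) p)"] Query.prems by auto
  let ?L = "?rhs (\<lambda>p. \<phi> (apfst (Cons (q, False)) p)) l (?A False)"
  let ?R = "?rhs (\<lambda>p. \<phi> (apfst (Cons (q, True)) p)) r (?A True)"
  have rhs: "?rhs \<phi> (Query q l r) A (\<lambda>n. n) = ?L c + ?R c"
    by (simp only: sum_paths_Query) (simp add: q c_def conj_assoc if_distrib cong: if_cong)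
  show ?case
  proof (cases "i0 = i")
    case True
    \<comment> \<open>A query to sample \<open>i\<close> stays in the tree and multiplies both sides
      by \<open>exp \<mu>\<close>.\<close>
    have pr: "?pr (?A a) = ?pr A" for a
      using True by (intro prod.cong refl) (auto intro!: arg_cong[where f="s _"])
    have c: "?L c = exp \<mu> * ?L (\<lambda>n. n)" "?R c = exp \<mu> * ?R (\<lambda>n. n)"
      using True by (simp_all add: c_def sum_distrib_left algebra_simps exp_add)
    have "?pay A (Query j tl tr) = exp \<mu> * ?pay (?A False) tl + exp \<mu> * ?pay (?A True) tr"
    proof -
      have "{x \<in> X. A i x} = {x \<in> X. ?A False i x} \<union> {x \<in> X. ?A True i x}"
        using True by auto
      then have "?pay A (Query j tl tr) = ?pay (?A False) (Query j tl tr) + ?pay (?A True) (Query j tl tr)"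
        using True \<open>finite X\<close> by (simp only:) (subst sum.union_disjoint, auto)
      moreover have "?pay (?A False) (Query j tl tr) = exp \<mu> * ?pay (?A False) tl"
        unfolding sum_distrib_left using True
        by (intro sum.cong refl) (auto simp: pay_def algebra_simps exp_add)
      moreover have "?pay (?A True) (Query j tl tr) = exp \<mu> * ?pay (?A True) tr"
        unfolding sum_distrib_left using True
        by (intro sum.cong refl) (auto simp: pay_def algebra_simps exp_add)
      ultimately show ?thesis by simp
    qed
    then have "?pr A * ?pay A (Query j tl tr)
        = exp \<mu> * (?pr (?A False) * ?pay (?A False) tl) + exp \<mu> * (?pr (?A True) * ?pay (?A True) tr)"
      unfolding pr by (simp add: algebra_simps)
    also have "\<dots> \<le> exp \<mu> * ?L (\<lambda>n. n) + exp \<mu> * ?R (\<lambda>n. n)"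
      by (intro add_mono mult_left_mono tl(3) tr(3)) auto
    also have "\<dots> = ?rhs \<phi> (Query q l r) A (\<lambda>n. n)"
      unfolding rhs c ..
    finally show ?thesis
      using tl(1,2) tr(1,2) j by (intro exI[of _ "Query j tl tr"]) auto
  next
    case False
    let ?rest = "\<Prod>j\<in>{..<k} - {i} - {i0}. s j (A j)"
    have pr: "?pr (?A a) = s i0 (\<lambda>x. A i0 x \<and> x ! j = a) * ?rest" for a
      using False i0 by (subst prod.remove[of _ i0]) (auto intro!: prod.cong arg_cong[where f="s _"])
    have "?pr A = s i0 (A i0) * ?rest"
      using False i0 by (subst prod.remove[of _ i0]) auto
    then have split: "?pr A = ?pr (?A False) + ?pr (?A True)"
      unfolding pr using additive[OF i0, of "A i0" "\<lambda>x. x ! j"] by (simp add: algebra_simps)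
    \<comment> \<open>A query to another sample does not restrict sample \<open>i\<close>, so the
      trees of both branches are judged on the same inputs and the cheaper one can replace the
      query.\<close>
    have pay_eq: "?pay (?A a) t = ?pay A t" for a t
      using False by simp
    define t where "t = (if ?pay A tl \<le> ?pay A tr then tl else tr)"
    have t: "?pay A t \<le> ?pay A tl" "?pay A t \<le> ?pay A tr" by (auto simp: t_def)
    have pr_nonneg: "?pr (?A a) \<ge> 0" for a by (intro prod_nonneg) (auto intro: nonneg)
    have "?pr A * ?pay A t \<le> ?pr (?A False) * ?pay A tl + ?pr (?A True) * ?pay A tr"
      unfolding split distrib_right by (intro add_mono mult_left_mono t pr_nonneg)
    also have "\<dots> \<le> ?L (\<lambda>n. n) + ?R (\<lambda>n. n)"
      using tl(3) tr(3) unfolding pay_eq by (rule add_mono)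
    also have "\<dots> = ?rhs \<phi> (Query q l r) A (\<lambda>n. n)"
      unfolding rhs using False by (simp add: c_def)
    finally show ?thesis
      using tl(1,2) tr(1,2) by (intro exI[of _ t]) (auto simp: t_def)
  qed
qed

section \<open>Forecasts from correlated samples\<close>

text \<open>If no coordinate succeeded, summing over \<open>I\<close> would bound the total
  single-coordinate distance \<open>H\<close> by
  \<open>3 * (\<mu> * d) + 2 * (\<mu> * d) * H\<close>. Subadditivity forces
  \<open>H \<ge> 1 / 72\<close>, which is incompatible with
  \<open>\<mu> * d \<le> 1 / 300\<close>.\<close>

lemma progress_per_query:
  fixes q0 q1 :: "'i \<Rightarrow> 'v \<Rightarrow> real" and c :: "'i \<Rightarrow> 'v \<Rightarrow> nat" and \<mu> :: real
  assumes fin: "finite I"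
    and nonneg: "\<And>i v. q0 i v \<ge> 0" "\<And>i v. q1 i v \<ge> 0"
    and mix: "\<And>p. 0 \<le> p \<Longrightarrow> p \<le> 1 \<Longrightarrow> (\<Sum>v\<in>V. \<Prod>i\<in>I. (1 - p) * q0 i v + p * q1 i v) = 1"
    and flip: "\<And>i. i \<in> I \<Longrightarrow> (\<Sum>v\<in>V. q1 i v * (\<Prod>j\<in>I - {i}. q0 j v)) = 1"
    and cost: "\<And>v. v \<in> V \<Longrightarrow> (\<Sum>i\<in>I. c i v) \<le> d"
    and dist: "(\<Sum>v\<in>V. \<Prod>i\<in>I. sqrt (q0 i v) * sqrt (q1 i v)) \<le> 17 / 18"
    and \<mu>: "\<mu> \<ge> 0" "\<mu> * d \<le> 1 / 300"
  shows "\<exists>i\<in>I. (\<Sum>v\<in>V. (\<Prod>j\<in>I - {i}. q0 j v) * exp (\<mu> * c i v) * (sqrt (q0 i v) * sqrt (q1 i v))) < 1"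
proof (rule ccontr)
  assume "\<not> ?thesis"
  then have large: "1 \<le> (\<Sum>v\<in>V. (\<Prod>j\<in>I - {i}. q0 j v) * exp (\<mu> * c i v) * (sqrt (q0 i v) * sqrt (q1 i v)))"
    if "i \<in> I" for i using that by force
  define W where "W = (\<lambda>i v. \<Prod>j\<in>I - {i}. q0 j v)"
  \<comment> \<open>\<open>S i\<close> sums to the affinity between the product of all
    \<open>q0\<close> and the same product with coordinate \<open>i\<close> changed to
    \<open>q1\<close>; \<open>h i\<close> is the squared distance caused by this change.\<close>
  define S where "S = (\<lambda>i v. sqrt (q0 i v) * sqrt (q1 i v) * W i v)"
  define h where "h = (\<lambda>i. 1 - (\<Sum>v\<in>V. S i v))"
  define H where "H = (\<Sum>i\<in>I. h i)"
  define P where "P = (\<lambda>v. \<Prod>i\<in>I. q0 i v)"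
  have W: "W i v \<ge> 0" for i v unfolding W_def by (intro prod_nonneg) (simp add: nonneg)
  have P: "P v \<ge> 0" for v unfolding P_def by (intro prod_nonneg) (simp add: nonneg)
  have q0W: "q0 i v * W i v = P v" if "i \<in> I" for i v
    unfolding W_def P_def using fin that by (rule prod.remove[symmetric])
  have sumP: "(\<Sum>v\<in>V. P v) = 1" using mix[of 0] by (simp add: P_def)
  have "1 - (\<Sum>v\<in>V. \<Prod>i\<in>I. sqrt (q0 i v) * sqrt (q1 i v)) \<le> 4 * H"
    using hellinger_subadditive[OF fin, where V = V and a = "\<lambda>i v. sqrt (q0 i v)" and b = "\<lambda>i v. sqrt (q1 i v)"] mix nonneg
    by (simp add: H_def h_def S_def W_def)
  \<comment> \<open>\<open>1 / 72\<close> is \<open>(1 - 17 / 18) / 4\<close>.\<close>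
  with dist have H: "H \<ge> 1 / 72" by simp
  have bound: "(\<Sum>v\<in>V. W i v * exp (\<mu> * c i v) * (sqrt (q0 i v) * sqrt (q1 i v)))
      \<le> 1 - h i + 3 * \<mu> * (\<Sum>v\<in>V. c i v * P v) + 2 * (\<mu> * d) * h i" if i: "i \<in> I" for i
  proof -
    define B where "B = (\<lambda>v. q1 i v * W i v)"
    have "(\<Sum>v\<in>V. W i v * exp (\<mu> * c i v) * (sqrt (q0 i v) * sqrt (q1 i v)))
        \<le> (\<Sum>v\<in>V. S i v + 3 * \<mu> * (c i v * P v) + \<mu> * d * (P v + B v - 2 * S i v))"
    proof (rule sum_mono)
      fix v assume v: "v \<in> V"
      have "c i v \<le> (\<Sum>i\<in>I. c i v)" using fin i by (intro member_le_sum) auto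
      also have "\<dots> \<le> d" using cost v .
      finally have c: "\<mu> * c i v \<le> \<mu> * d" using \<mu>(1) by (intro mult_left_mono) auto
      have e: "exp (\<mu> * c i v) \<le> 1 + 2 * (\<mu> * c i v)"
      proof -
        have "exp (\<mu> * c i v) \<le> 1 + \<mu> * c i v + (\<mu> * c i v)\<^sup>2"
          using \<mu> c by (intro exp_bound) auto
        moreover have "(\<mu> * c i v)\<^sup>2 \<le> \<mu> * c i v"
          using \<mu> c unfolding power2_eq_square by (intro mult_left_le) auto
        ultimately show ?thesis by simp
      qed
      define x y where "x = sqrt (q0 i v)" and "y = sqrt (q1 i v)"
      have xy: "x \<ge> 0" "y \<ge> 0" "q0 i v = x\<^sup>2" "q1 i v = y\<^sup>2" by (auto simp: x_def y_def nonneg)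
      have S: "S i v = x * y * W i v" by (simp add: S_def x_def y_def)
      have PB: "P v = x\<^sup>2 * W i v" "B v = y\<^sup>2 * W i v"
        using q0W[OF i] by (simp_all add: B_def flip: xy(3,4))
      have S0: "S i v \<ge> 0" using xy W by (simp add: S)
      have T0: "P v + B v - 2 * S i v = (x - y)\<^sup>2 * W i v"
        unfolding PB S by (simp add: power2_diff algebra_simps)
      \<comment> \<open>The cost is charged to \<open>P\<close>, under which all coordinates
        together are read at most \<open>d\<close> times. The excess goes to the distance term,
        whose coefficient \<open>\<mu> * d\<close> is small.\<close>
      have "2 * S i v \<le> 3 * P v + (P v + B v - 2 * S i v)"
      proof -
        have "0 \<le> (2 * x - y)\<^sup>2 * W i v" using W by simp
        also have "\<dots> = 3 * P v + (P v + B v - 2 * S i v) - 2 * S i v"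
          unfolding PB S by (simp add: power2_diff power_mult_distrib algebra_simps)
        finally show ?thesis by simp
      qed
      then have "\<mu> * c i v * (2 * S i v) \<le> \<mu> * c i v * (3 * P v + (P v + B v - 2 * S i v))"
        using \<mu> by (intro mult_left_mono) auto
      also have "\<dots> \<le> 3 * \<mu> * (c i v * P v) + \<mu> * d * (P v + B v - 2 * S i v)"
      proof -
        have "P v + B v - 2 * S i v \<ge> 0" unfolding T0 using W by simp
        from mult_right_mono[OF c this] show ?thesis by (simp add: algebra_simps)
      qed
      finally have main: "\<mu> * c i v * (2 * S i v) \<le> 3 * \<mu> * (c i v * P v) + \<mu> * d * (P v + B v - 2 * S i v)" .
      have "W i v * exp (\<mu> * c i v) * (sqrt (q0 i v) * sqrt (q1 i v)) = exp (\<mu> * c i v) * S i v"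
        by (simp add: S_def)
      also have "\<dots> \<le> (1 + 2 * (\<mu> * c i v)) * S i v" by (intro mult_right_mono e S0)
      also have "\<dots> = S i v + \<mu> * c i v * (2 * S i v)" by (simp add: algebra_simps)
      finally show "W i v * exp (\<mu> * c i v) * (sqrt (q0 i v) * sqrt (q1 i v))
          \<le> S i v + 3 * \<mu> * (c i v * P v) + \<mu> * d * (P v + B v - 2 * S i v)"
        using main by simp
    qed
    also have "\<dots> = (\<Sum>v\<in>V. S i v) + 3 * \<mu> * (\<Sum>v\<in>V. c i v * P v)
        + \<mu> * d * ((\<Sum>v\<in>V. P v) + (\<Sum>v\<in>V. B v) - 2 * (\<Sum>v\<in>V. S i v))"
      by (simp add: sum.distrib sum_subtractf sum_distrib_left[symmetric])
    also have "(\<Sum>v\<in>V. B v) = 1" using flip[OF i] by (simp add: B_def W_def)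
    finally show ?thesis by (simp add: sumP h_def algebra_simps)
  qed
  have "(\<Sum>i\<in>I. \<Sum>v\<in>V. c i v * P v) = (\<Sum>v\<in>V. real (\<Sum>i\<in>I. c i v) * P v)"
    by (subst sum.swap) (simp add: sum_distrib_right)
  also have "\<dots> \<le> (\<Sum>v\<in>V. real d * P v)"
    using cost P by (intro sum_mono mult_right_mono) (auto simp del: of_nat_sum)
  also have "\<dots> = d" by (simp add: sumP flip: sum_distrib_left)
  finally have total: "3 * \<mu> * (\<Sum>i\<in>I. \<Sum>v\<in>V. c i v * P v) \<le> 3 * \<mu> * d"
    using \<mu> by (intro mult_left_mono) auto
  have "(\<Sum>i\<in>I. 1 :: real) \<le> (\<Sum>i\<in>I. 1 - h i + 3 * \<mu> * (\<Sum>v\<in>V. c i v * P v) + 2 * (\<mu> * d) * h i)"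
    by (intro sum_mono order.trans[OF large bound[unfolded W_def]])
  also have "\<dots> = (\<Sum>i\<in>I. 1) - H + 3 * \<mu> * (\<Sum>i\<in>I. \<Sum>v\<in>V. c i v * P v) + 2 * (\<mu> * d) * H"
    by (simp add: H_def sum.distrib sum_subtractf sum_distrib_left)
  finally have "H \<le> 3 * (\<mu> * d) + 2 * (\<mu> * d) * H" using total by simp
  also have "\<dots> \<le> 3 * (1 / 300) + 2 * (1 / 300) * H"
    using \<mu> H by (intro add_mono mult_right_mono mult_left_mono) auto
  finally show False using H by simp
qed

text \<open>Half the log-likelihood ratio, \<open>ln (sqrt (B v) / sqrt (A v))\<close>, would give
  exactly \<open>sqrt (A v) * sqrt (B v)\<close>. Adding \<open>\<delta> > 0\<close> to both roots
  keeps it finite where one of them vanishes, at a total cost of at most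
  \<open>\<delta> * s\<close>.\<close>

lemma log_ratio_labels:
  fixes E A B :: "'v \<Rightarrow> real"
  assumes nonneg: "\<And>v. E v \<ge> 0" "\<And>v. A v \<ge> 0" "\<And>v. B v \<ge> 0"
    and "(\<Sum>v\<in>V. E v * (sqrt (A v) * sqrt (B v))) < 1"
  shows "\<exists>l. (\<Sum>v\<in>V. E v * ((B v * exp (- l v) + A v * exp (l v)) / 2)) < 1"
proof -
  define s where "s = (\<Sum>v\<in>V. E v * ((sqrt (A v) + sqrt (B v)) / 2))"
  define g where "g = 1 - (\<Sum>v\<in>V. E v * (sqrt (A v) * sqrt (B v)))"
  \<comment> \<open>This makes \<open>\<delta> * s\<close> smaller than the gap
    \<open>g\<close>.\<close>
  define \<delta> where "\<delta> = g / (1 + s)"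
  have s: "s \<ge> 0" unfolding s_def by (intro sum_nonneg) (simp add: nonneg)
  have g: "g > 0" using assms(4) by (simp add: g_def)
  have \<delta>: "\<delta> > 0" using s g by (simp add: \<delta>_def)
  define l where "l = (\<lambda>v. ln ((sqrt (B v) + \<delta>) / (sqrt (A v) + \<delta>)))"
  have "(\<Sum>v\<in>V. E v * ((B v * exp (- l v) + A v * exp (l v)) / 2))
      \<le> (\<Sum>v\<in>V. E v * (sqrt (A v) * sqrt (B v)) + \<delta> * (E v * ((sqrt (A v) + sqrt (B v)) / 2)))"
  proof (rule sum_mono)
    fix v
    define x y where "x = sqrt (A v)" and "y = sqrt (B v)"
    have xy: "x \<ge> 0" "y \<ge> 0" "A v = x\<^sup>2" "B v = y\<^sup>2" by (auto simp: x_def y_def nonneg)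
    have pos: "x + \<delta> > 0" "y + \<delta> > 0" using xy \<delta> by auto
    have el: "exp (l v) = (y + \<delta>) / (x + \<delta>)" "exp (- l v) = (x + \<delta>) / (y + \<delta>)"
      using pos by (auto simp: l_def x_def[symmetric] y_def[symmetric] exp_minus)
    have "y\<^sup>2 / (y + \<delta>) \<le> y" using pos xy \<delta> by (simp add: divide_simps power2_eq_square algebra_simps)
    then have "B v * exp (- l v) \<le> y * (x + \<delta>)"
      using mult_right_mono[of "y\<^sup>2 / (y + \<delta>)" y "x + \<delta>"] pos by (simp add: el xy)
    moreover have "x\<^sup>2 / (x + \<delta>) \<le> x" using pos xy \<delta> by (simp add: divide_simps power2_eq_square algebra_simps)
    then have "A v * exp (l v) \<le> x * (y + \<delta>)"
      using mult_right_mono[of "x\<^sup>2 / (x + \<delta>)" x "y + \<delta>"] pos by (simp add: el xy)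
    ultimately have "(B v * exp (- l v) + A v * exp (l v)) / 2 \<le> (y * (x + \<delta>) + x * (y + \<delta>)) / 2"
      by simp
    also have "\<dots> = x * y + \<delta> * ((x + y) / 2)" by (simp add: field_simps)
    finally have "(B v * exp (- l v) + A v * exp (l v)) / 2 \<le> x * y + \<delta> * ((x + y) / 2)" .
    then have "E v * ((B v * exp (- l v) + A v * exp (l v)) / 2) \<le> E v * (x * y + \<delta> * ((x + y) / 2))"
      by (intro mult_left_mono nonneg)
    then show "E v * ((B v * exp (- l v) + A v * exp (l v)) / 2)
        \<le> E v * (sqrt (A v) * sqrt (B v)) + \<delta> * (E v * ((sqrt (A v) + sqrt (B v)) / 2))"
      by (simp add: x_def y_def algebra_simps)
  qed
  also have "\<dots> = 1 - g + \<delta> * s" by (simp add: sum.distrib s_def g_def sum_distrib_left)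
  also have "\<dots> < 1"
    using s g by (simp add: \<delta>_def divide_simps algebra_simps)
  finally show ?thesis by blast
qed

section \<open>From trees on correlated samples to forecasts on one input\<close>

lemma prob_half_mix:
  "measure_pmf.prob (half_mix M) A = (measure_pmf.prob (M True) A + measure_pmf.prob (M False) A) / 2"
  by (simp add: half_mix_def measure_bind_pmf)

lemma prob_half_mix_samples:
  assumes "D \<in> balanced n f"
  shows "measure_pmf.prob (half_mix (\<lambda>b. replicate_pmf k (D b))) {xs. g xs = map f xs}
    = (measure_pmf.prob (replicate_pmf k (D True)) {xs. g xs = replicate k (Some True)}
      + measure_pmf.prob (replicate_pmf k (D False)) {xs. g xs = replicate k (Some False)}) / 2"
proof -
  have "map f xs = replicate k (Some b)" if "xs \<in> set_pmf (replicate_pmf k (D b))" for b xs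
    using assms that
    by (intro replicate_eqI) (auto simp: balanced_def set_replicate_pmf fibre_def subset_iff in_lists_conv_set)
  then have "measure_pmf.prob (replicate_pmf k (D b)) {xs. g xs = map f xs}
      = measure_pmf.prob (replicate_pmf k (D b)) {xs. g xs = replicate k (Some b)}" for b
    by (intro measure_pmf.finite_measure_eq_AE) (auto simp: AE_measure_pmf_iff)
  then show ?thesis by (simp add: prob_half_mix)
qed

definition agree_prob :: "bool list pmf \<Rightarrow> nat \<Rightarrow> ((nat \<times> nat) \<times> bool) list \<times> 'o \<Rightarrow> real" where
  "agree_prob M i p = measure_pmf.prob M {x. agrees (fst p) i x}"

text \<open>For \<open>k \<ge> 1\<close> the two correct answers differ, so each path is correct
  under at most one of the two hypotheses, and success \<open>2 / 3\<close> forces the transcript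
  distributions apart.\<close>

lemma affinity_le_of_success:
  assumes "D \<in> balanced n f" "k \<ge> 1" "queries T \<subseteq> {..<k} \<times> {..<n}"
    and success: "measure_pmf.prob (half_mix (\<lambda>b. replicate_pmf k (D b)))
       {xs. run T (\<lambda>(i, j). xs ! i ! j) = map f xs} \<ge> 2 / 3"
  shows "(\<Sum>p\<in>paths T. \<Prod>i<k. sqrt (agree_prob (D False) i p) * sqrt (agree_prob (D True) i p)) \<le> 17 / 18"
proof -
  define P :: "bool \<Rightarrow> ((nat \<times> nat) \<times> bool) list \<times> bool option list \<Rightarrow> real"
    where "P = (\<lambda>b p. \<Prod>i<k. agree_prob (D b) i p)"
  define S where "S = (\<lambda>b p. if snd p = replicate k (Some b) then P b p else 0)"
  have "measure_pmf.prob (replicate_pmf k (D b)) {xs. run T (\<lambda>(i, j). xs ! i ! j) = replicate k (Some b)}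
      = (\<Sum>p\<in>paths T. S b p)" for b
    using prob_run_replicate_pmf[OF assms(3), of "D b" "\<lambda>_ _. True"]
    by (simp add: S_def P_def agree_prob_def cong: if_cong)
  then have "(\<Sum>p\<in>paths T. S True p) + (\<Sum>p\<in>paths T. S False p) \<ge> 4 / 3"
    using success unfolding prob_half_mix_samples[OF assms(1)] by simp
  moreover have "(\<Sum>p\<in>paths T. P b p) = 1" for b
    using sum_paths_product[of k "\<lambda>_ A. measure_pmf.prob (D b) {x. A x}" T "{..<n}" "\<lambda>_ _. True"] assms(3)
    by (simp add: P_def agree_prob_def prob_split[symmetric])
  \<comment> \<open>The squares of \<open>3 * x - 4 * y\<close> and \<open>4 * x - 3 * y\<close>
    supply the coefficients; the right side sums to at most
    \<open>(16 * 2 - 7 * (4 / 3)) / 24 = 17 / 18\<close>.\<close>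
  moreover have "(\<Sum>p\<in>paths T. \<Prod>i<k. sqrt (agree_prob (D False) i p) * sqrt (agree_prob (D True) i p))
      \<le> (\<Sum>p\<in>paths T. (16 * (P False p + P True p) - 7 * (S True p + S False p)) / 24)"
  proof (rule sum_mono)
    fix p :: "((nat \<times> nat) \<times> bool) list \<times> bool option list"
    define x y where "x = (\<Prod>i<k. sqrt (agree_prob (D False) i p))"
      and "y = (\<Prod>i<k. sqrt (agree_prob (D True) i p))"
    have P: "P False p = x\<^sup>2" "P True p = y\<^sup>2"
      by (simp_all add: P_def x_def y_def agree_prob_def prod_power_distrib)
    have "replicate k (Some True) \<noteq> replicate k (Some False)" using \<open>k \<ge> 1\<close> by (cases k) auto
    then have "S True p + S False p \<in> {0, x\<^sup>2, y\<^sup>2}"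
      by (auto simp: S_def P)
    moreover have "24 * (x * y) \<le> 9 * x\<^sup>2 + 16 * y\<^sup>2"
      using zero_le_power2[of "3 * x - 4 * y"] by (simp add: power2_diff power_mult_distrib)
    moreover have "24 * (x * y) \<le> 16 * x\<^sup>2 + 9 * y\<^sup>2"
      using zero_le_power2[of "4 * x - 3 * y"] by (simp add: power2_diff power_mult_distrib)
    moreover have "x\<^sup>2 \<ge> 0" "y\<^sup>2 \<ge> 0" by simp_all
    ultimately have "x * y \<le> (16 * (x\<^sup>2 + y\<^sup>2) - 7 * (S True p + S False p)) / 24"
      unfolding insert_iff empty_iff by (elim disjE) (argo | blast)+
    then show "(\<Prod>i<k. sqrt (agree_prob (D False) i p) * sqrt (agree_prob (D True) i p))
        \<le> (16 * (P False p + P True p) - 7 * (S True p + S False p)) / 24"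
      by (simp add: P prod.distrib x_def y_def)
  qed
  ultimately show ?thesis
    by (simp add: sum_subtractf sum.distrib flip: sum_distrib_left sum_divide_distrib)
qed

lemma sum_domain_split:
  fixes g :: "bool list \<Rightarrow> real"
  shows "(\<Sum>x\<in>{x\<in>fibre n f True \<union> fibre n f False. Q x}. g x)
    = (\<Sum>x\<in>{x\<in>fibre n f True. Q x}. g x) + (\<Sum>x\<in>{x\<in>fibre n f False. Q x}. g x)"
proof -
  have "{x\<in>fibre n f True \<union> fibre n f False. Q x}
      = {x\<in>fibre n f True. Q x} \<union> {x\<in>fibre n f False. Q x}" by auto
  moreover have "{x\<in>fibre n f True. Q x} \<inter> {x\<in>fibre n f False. Q x} = {}" by (auto simp: fibre_def)
  ultimately show ?thesis by (simp add: sum.union_disjoint finite_fibre)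
qed

lemma prob_balanced:
  assumes "D \<in> balanced n f"
  shows "measure_pmf.prob (D b) {x. Q x} = (\<Sum>x\<in>{x\<in>fibre n f b. Q x}. pmf (D b) x)"
proof -
  have "measure_pmf.prob (D b) {x. Q x} = measure_pmf.prob (D b) {x\<in>fibre n f b. Q x}"
    using assms by (intro measure_pmf.finite_measure_eq_AE) (auto simp: AE_measure_pmf_iff balanced_def)
  then show ?thesis by (simp add: measure_measure_pmf_finite finite_fibre)
qed

text \<open>With the paths of \<open>T\<close> as outcomes, \<open>progress_per_query\<close>
  selects a sample \<open>i\<close>, \<open>log_ratio_labels\<close> turns its affinities into leaf
  labels, and \<open>restrict_to_sample\<close> extracts a tree on that sample alone.\<close>

lemma forecast_for_balanced:
  fixes \<mu> :: real
  assumes D: "D \<in> balanced n f" and "k \<ge> 1" and T: "queries T \<subseteq> {..<k} \<times> {..<n}" "depth T \<le> d"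
    and success: "measure_pmf.prob (half_mix (\<lambda>b. replicate_pmf k (D b)))
       {xs. run T (\<lambda>(i, j). xs ! i ! j) = map f xs} \<ge> 2 / 3"
    and \<mu>: "\<mu> \<ge> 0" "\<mu> * d \<le> 1 / 300"
  shows "\<exists>t. queries t \<subseteq> {..<n} \<and> depth t \<le> d \<and>
    (\<Sum>x\<in>fibre n f True \<union> fibre n f False. pmf (D (the (f x))) x / 2 * pay \<mu> t (the (f x)) (\<lambda>j. x ! j)) < 1"
proof -
  let ?q = "\<lambda>b. agree_prob (D b)"
  define X where "X = fibre n f True \<union> fibre n f False"
  let ?m = "\<lambda>x. pmf (D (the (f x))) x / 2"
  have "finite X" by (simp add: X_def finite_fibre)
  have "\<exists>i\<in>{..<k}. (\<Sum>p\<in>paths T. (\<Prod>j\<in>{..<k} - {i}. ?q False j p) * exp (\<mu> * reads (fst p) i)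
      * (sqrt (?q False i p) * sqrt (?q True i p))) < 1"
  proof (rule progress_per_query)
    fix p :: real assume "0 \<le> p" "p \<le> 1"
    \<comment> \<open>Each sample independently comes from \<open>D True\<close> with probability
      \<open>p\<close>.\<close>
    let ?s = "\<lambda>A. (1 - p) * measure_pmf.prob (D False) {x. A x} + p * measure_pmf.prob (D True) {x. A x}"
    have "?s A = ?s (\<lambda>x. A x \<and> B x) + ?s (\<lambda>x. A x \<and> \<not> B x)" for A B
      by (subst (1 2) prob_split[of _ A B]) (simp add: algebra_simps)
    from sum_paths_product[of k "\<lambda>_. ?s", OF this T(1), of "\<lambda>_ _. True"]
    show "(\<Sum>v\<in>paths T. \<Prod>i<k. (1 - p) * ?q False i v + p * ?q True i v) = 1"
      by (simp add: agree_prob_def)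
  next
    fix i assume i: "i \<in> {..<k}"
    \<comment> \<open>Only sample \<open>i\<close> comes from \<open>D True\<close>, the others from
      \<open>D False\<close>.\<close>
    let ?s = "\<lambda>j A. measure_pmf.prob (D (j = i)) {x. A x}"
    have "(\<Sum>v\<in>paths T. \<Prod>j<k. ?s j (\<lambda>x. agrees (fst v) j x)) = 1"
      using sum_paths_product[of k ?s, OF prob_split T(1), of "\<lambda>_ _. True"] by simp
    moreover have "(\<Prod>j<k. ?s j (\<lambda>x. agrees (fst v) j x)) = ?q True i v * (\<Prod>j\<in>{..<k} - {i}. ?q False j v)"
      for v :: "((nat \<times> nat) \<times> bool) list \<times> bool option list"
      using i by (subst prod.remove[of _ i]) (auto simp: agree_prob_def intro!: prod.cong)
    ultimately show "(\<Sum>v\<in>paths T. ?q True i v * (\<Prod>j\<in>{..<k} - {i}. ?q False j v)) = 1"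
      by simp
  next
    fix p assume "p \<in> paths T"
    then show "(\<Sum>i<k. reads (fst p) i) \<le> d"
      using sum_reads_le[of "{..<k}" "fst p"] length_path_le_depth[of p T] T(2) by simp
  next
    show "(\<Sum>p\<in>paths T. \<Prod>i<k. sqrt (?q False i p) * sqrt (?q True i p)) \<le> 17 / 18"
      using affinity_le_of_success[OF D \<open>k \<ge> 1\<close> T(1) success] .
  qed (use \<mu> in \<open>auto simp: agree_prob_def\<close>)
  then obtain i where i: "i < k" and small: "(\<Sum>p\<in>paths T. (\<Prod>j\<in>{..<k} - {i}. ?q False j p)
      * exp (\<mu> * reads (fst p) i) * (sqrt (?q False i p) * sqrt (?q True i p))) < 1"
    by auto
  obtain l where l: "(\<Sum>p\<in>paths T. (\<Prod>j\<in>{..<k} - {i}. ?q False j p) * exp (\<mu> * reads (fst p) i)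
      * ((?q True i p * exp (- l p) + ?q False i p * exp (l p)) / 2)) < 1"
    using log_ratio_labels[OF _ _ _ small] by (auto simp: agree_prob_def prod_nonneg)
  let ?s = "\<lambda>j A. measure_pmf.prob (D False) {x. A x}"
  have "\<exists>t. queries t \<subseteq> {..<n} \<and> depth t \<le> depth T \<and>
    (\<Sum>x\<in>X. ?m x * pay \<mu> t (the (f x)) (\<lambda>j. x ! j))
      \<le> (\<Sum>p\<in>paths T. (\<Prod>j\<in>{..<k} - {i}. ?q False j p) * (exp (\<mu> * reads (fst p) i) *
          (\<Sum>x\<in>{x\<in>X. agrees (fst p) i x}. ?m x * wt (the (f x)) (l p))))"
    using restrict_to_sample[of k ?s T "{..<n}" X i "\<lambda>_ _. True" ?m \<mu> "\<lambda>x. the (f x)" l,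
        OF prob_split _ T(1) _ i]
    by (simp add: \<open>finite X\<close> agree_prob_def)
  then obtain t where t: "queries t \<subseteq> {..<n}" "depth t \<le> depth T"
    "(\<Sum>x\<in>X. ?m x * pay \<mu> t (the (f x)) (\<lambda>j. x ! j))
      \<le> (\<Sum>p\<in>paths T. (\<Prod>j\<in>{..<k} - {i}. ?q False j p) * (exp (\<mu> * reads (fst p) i) *
          (\<Sum>x\<in>{x\<in>X. agrees (fst p) i x}. ?m x * wt (the (f x)) (l p))))"
    by blast
  have "(\<Sum>x\<in>{x\<in>X. agrees (fst p) i x}. ?m x * wt (the (f x)) (l p))
      = (?q True i p * exp (- l p) + ?q False i p * exp (l p)) / 2" for p
  proof -
    have "(\<Sum>x\<in>{x\<in>fibre n f b. agrees (fst p) i x}. ?m x * wt (the (f x)) (l p)) = ?q b i p * wt b (l p) / 2" for b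
      unfolding agree_prob_def prob_balanced[OF D] sum_distrib_right sum_divide_distrib
      by (intro sum.cong) (auto simp: fibre_def)
    from this[of True] this[of False] show ?thesis
      by (simp only: X_def sum_domain_split) (simp add: wt_def add_divide_distrib)
  qed
  with t(3) have "(\<Sum>x\<in>X. ?m x * pay \<mu> t (the (f x)) (\<lambda>j. x ! j)) < 1"
    by (intro le_less_trans[OF _ l]) (simp only: mult.assoc)
  with t(1,2) T(2) show ?thesis unfolding X_def by (intro exI[of _ t]) auto
qed

section \<open>Comparison of the two measures\<close>

primrec read_all :: "'q list \<Rightarrow> (bool list \<Rightarrow> 'o) \<Rightarrow> ('q, 'o) dtree" where
  "read_all [] g = Leaf (g [])"
| "read_all (q # qs) g = Query q (read_all qs (\<lambda>v. g (False # v))) (read_all qs (\<lambda>v. g (True # v)))"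

lemma run_read_all: "run (read_all qs g) ans = g (map ans qs)"
proof (induction qs arbitrary: g)
  case (Cons q qs)
  then show ?case by (cases "ans q") auto
qed simp

lemma queries_read_all: "queries (read_all qs g) \<subseteq> set qs"
  by (induction qs arbitrary: g) fastforce+

text \<open>Reading the whole input makes no error, so the \<open>LEAST\<close> in
  \<open>R_err\<close> ranges over a nonempty set and is attained.\<close>

lemma R_err_witness:
  assumes "0 \<le> \<epsilon>"
  obtains P where "\<And>t. t \<in> set_pmf P \<Longrightarrow> queries t \<subseteq> {..<n} \<and> depth t \<le> R_err \<epsilon> n f"
    "\<And>b x. x \<in> fibre n f b \<Longrightarrow> measure_pmf.prob P {t. run t (\<lambda>i. x ! i) = b} \<ge> 1 - \<epsilon>"
proof -
  let ?good = "\<lambda>d. \<exists>P :: (nat, bool) dtree pmf.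
     (\<forall>t\<in>set_pmf P. queries t \<subseteq> {..<n} \<and> depth t \<le> d) \<and>
     (\<forall>b. \<forall>x\<in>fibre n f b. measure_pmf.prob P {t. run t (\<lambda>i. x ! i) = b} \<ge> 1 - \<epsilon>)"
  define t where "t = read_all [0..<n] (\<lambda>v. f v = Some True)"
  have "run t (\<lambda>i. x ! i) = b" if "x \<in> fibre n f b" for x b
    using that by (auto simp: t_def run_read_all fibre_def map_nth)
  moreover have "queries t \<subseteq> {..<n}"
    using queries_read_all[of "[0..<n]"] by (force simp: t_def)
  ultimately have "?good (depth t)"
    using assms by (intro exI[of _ "return_pmf t"]) (auto simp: indicator_def)
  then have "?good (R_err \<epsilon> n f)"
    unfolding R_err_def by (rule LeastI)
  then show ?thesis using that by blast
qed

lemma run_map_dtree: "run (map_dtree g h t) ans = h (run t (\<lambda>q. ans (g q)))"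
  by (induction t) auto

lemma queries_map_dtree: "queries (map_dtree g h t) = g ` queries t"
  by (induction t) auto

lemma depth_map_dtree: "depth (map_dtree g h t) = depth t"
  by (induction t) auto

text \<open>Some tree in the support does at least as well on average as the randomized one; it
  reads sample \<open>0\<close> only and repeats its answer \<open>k\<close> times. The case
  \<open>k = 1\<close> bounds \<open>Corr_dist\<close>, and general \<open>k\<close> shows that the
  least depth in \<open>D_err\<close> is attained.\<close>

lemma tree_for_samples:
  assumes "0 \<le> \<epsilon>" "D \<in> balanced n f" "k \<ge> 1"
  shows "\<exists>T. queries T \<subseteq> {..<k} \<times> {..<n} \<and> depth T \<le> R_err \<epsilon> n f \<and>
    measure_pmf.prob (half_mix (\<lambda>b. replicate_pmf k (D b)))
      {xs. run T (\<lambda>(i, j). xs ! i ! j) = map f xs} \<ge> 1 - \<epsilon>"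
proof -
  obtain P where P: "\<And>t. t \<in> set_pmf P \<Longrightarrow> queries t \<subseteq> {..<n} \<and> depth t \<le> R_err \<epsilon> n f"
    "\<And>b x. x \<in> fibre n f b \<Longrightarrow> measure_pmf.prob P {t. run t (\<lambda>i. x ! i) = b} \<ge> 1 - \<epsilon>"
    using R_err_witness[OF assms(1)] by metis
  define g where "g = (\<lambda>t b. measure_pmf.prob (D b) {x. run t (\<lambda>i. x ! i) = b})"
  have int: "integrable P (\<lambda>t. g t b)" for b
    unfolding g_def by (intro measure_pmf.integrable_const_bound[where B=1]) auto
  have "1 - \<epsilon> \<le> measure_pmf.expectation P (\<lambda>t. g t b)" for b
  proof -
    have "1 - \<epsilon> \<le> measure_pmf.expectation (D b) (\<lambda>x. measure_pmf.prob P {t. run t (\<lambda>i. x ! i) = b})"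
      using assms(2) P(2)
      by (intro measure_pmf.integral_ge_const measure_pmf.integrable_const_bound[where B=1])
         (auto simp: AE_measure_pmf_iff balanced_def subset_iff)
    also have "\<dots> = measure_pmf.prob (bind_pmf (D b) (\<lambda>x. bind_pmf P (\<lambda>t. return_pmf (run t (\<lambda>i. x ! i))))) {b}"
      by (simp add: measure_bind_pmf map_pmf_def[symmetric] vimage_def)
    also have "\<dots> = measure_pmf.prob (bind_pmf P (\<lambda>t. bind_pmf (D b) (\<lambda>x. return_pmf (run t (\<lambda>i. x ! i))))) {b}"
      by (subst bind_commute_pmf) simp
    also have "\<dots> = measure_pmf.expectation P (\<lambda>t. g t b)"
      by (simp add: measure_bind_pmf map_pmf_def[symmetric] vimage_def g_def)
    finally show ?thesis .
  qed
  from this[of True] this[of False] int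
  have avg: "1 - \<epsilon> \<le> measure_pmf.expectation P (\<lambda>t. (g t True + g t False) / 2)"
    by simp
  obtain t where t: "t \<in> set_pmf P" "(g t True + g t False) / 2 \<ge> 1 - \<epsilon>"
  proof (rule ccontr)
    assume "\<not> thesis"
    with that have "AE t in P. (g t True + g t False) / 2 < 1 - \<epsilon>"
      by (auto simp: AE_measure_pmf_iff not_le[symmetric])
    then have "measure_pmf.expectation P (\<lambda>t. (g t True + g t False) / 2) < 1 - \<epsilon>"
      using int by (intro measure_pmf.expectation_less) auto
    with avg show False by simp
  qed
  define T where "T = map_dtree (Pair (0 :: nat)) (\<lambda>b. replicate k (Some b)) t"
  have "measure_pmf.prob (replicate_pmf k (D b)) {xs. run T (\<lambda>(i, j). xs ! i ! j) = replicate k (Some b)} = g t b" for b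
  proof -
    have "{xs. run T (\<lambda>(i, j). xs ! i ! j) = replicate k (Some b)}
        = {xs. \<forall>i<k. i = 0 \<longrightarrow> run t (\<lambda>j. xs ! i ! j) = b}"
      using assms(3) by (cases k) (auto simp: T_def run_map_dtree)
    then have "measure_pmf.prob (replicate_pmf k (D b)) {xs. run T (\<lambda>(i, j). xs ! i ! j) = replicate k (Some b)}
        = (\<Prod>i<k. measure_pmf.prob (D b) {x. i = 0 \<longrightarrow> run t (\<lambda>j. x ! j) = b})"
      using prob_replicate_pmf[of k "D b" "\<lambda>i x. i = 0 \<longrightarrow> run t (\<lambda>j. x ! j) = b"] by simp
    also have "\<dots> = g t b"
      using assms(3) by (subst prod.remove[of _ 0]) (auto simp: g_def)
    finally show ?thesis .
  qed
  then have "measure_pmf.prob (half_mix (\<lambda>b. replicate_pmf k (D b)))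
      {xs. run T (\<lambda>(i, j). xs ! i ! j) = map f xs} \<ge> 1 - \<epsilon>"
    using t(2) by (simp add: prob_half_mix_samples[OF assms(2)])
  moreover have "queries T \<subseteq> {..<k} \<times> {..<n}"
    using P(1)[OF t(1)] assms(3) by (auto simp: T_def queries_map_dtree)
  moreover have "depth T \<le> R_err \<epsilon> n f"
    using P(1)[OF t(1)] by (simp add: T_def depth_map_dtree)
  ultimately show ?thesis by blast
qed

lemma Corr_dist_le_R_err:
  assumes "0 \<le> \<epsilon>" "D \<in> balanced n f"
  shows "Corr_dist \<epsilon> n f D \<le> R_err \<epsilon> n f"
proof -
  have "Corr_dist \<epsilon> n f D \<le> D_err \<epsilon> ({..<1} \<times> {..<n}) (\<lambda>xs (i, j). xs ! i ! j) (map f)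
       (half_mix (\<lambda>b. replicate_pmf 1 (D b)))"
    unfolding Corr_dist_def by (intro cINF_lower) auto
  also have "\<dots> \<le> R_err \<epsilon> n f"
    unfolding D_err_def using tree_for_samples[OF assms, of 1] by (intro Least_le) simp
  finally show ?thesis .
qed

lemma Corr_err_le_R_err:
  assumes "0 \<le> \<epsilon>"
  shows "Corr_err \<epsilon> n f \<le> R_err \<epsilon> n f"
proof (cases "balanced n f = {}")
  case True
  then show ?thesis by (simp add: Corr_err_def Sup_nat_def)
next
  case False
  then show ?thesis
    unfolding Corr_err_def by (intro cSUP_least Corr_dist_le_R_err assms)
qed

lemma Corr_err_witness:
  assumes "0 \<le> \<epsilon>" "D \<in> balanced n f"
  obtains k T where "k \<ge> 1" "queries T \<subseteq> {..<k} \<times> {..<n}" "depth T \<le> Corr_err \<epsilon> n f"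
    "measure_pmf.prob (half_mix (\<lambda>b. replicate_pmf k (D b)))
      {xs. run T (\<lambda>(i, j). xs ! i ! j) = map f xs} \<ge> 1 - \<epsilon>"
proof -
  let ?D = "\<lambda>k. D_err \<epsilon> ({..<k} \<times> {..<n}) (\<lambda>xs (i, j). xs ! i ! j) (map f)
       (half_mix (\<lambda>b. replicate_pmf k (D b)))"
  have "Corr_dist \<epsilon> n f D \<in> ?D ` {1..}"
    unfolding Corr_dist_def by (rule Inf_nat_def1) auto
  then obtain k where k: "k \<ge> 1" "Corr_dist \<epsilon> n f D = ?D k" by auto
  have "\<exists>T. queries T \<subseteq> {..<k} \<times> {..<n} \<and> depth T \<le> ?D k \<and>
    measure_pmf.prob (half_mix (\<lambda>b. replicate_pmf k (D b)))
      {xs. run T (\<lambda>(i, j). xs ! i ! j) = map f xs} \<ge> 1 - \<epsilon>"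
    unfolding D_err_def by (rule LeastI, rule tree_for_samples[OF assms k(1)])
  \<comment> \<open>A supremum in \<open>nat\<close> dominates the members of a bounded family; the
    bound here is \<open>R_err \<epsilon> n f\<close>.\<close>
  moreover have "Corr_dist \<epsilon> n f D \<le> Corr_err \<epsilon> n f"
    unfolding Corr_err_def using assms
    by (intro cSUP_upper bdd_aboveI2[where M = "R_err \<epsilon> n f"] Corr_dist_le_R_err)
  ultimately obtain T where "queries T \<subseteq> {..<k} \<times> {..<n}" "depth T \<le> Corr_err \<epsilon> n f"
    "measure_pmf.prob (half_mix (\<lambda>b. replicate_pmf k (D b)))
      {xs. run T (\<lambda>(i, j). xs ! i ! j) = map f xs} \<ge> 1 - \<epsilon>"
    using k(2) by (auto dest: order.trans)
  then show ?thesis using that[OF k(1)] by blast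
qed

section \<open>Forecasts for arbitrary weights and the converse bound\<close>

lemma biased_label:
  fixes \<alpha> \<beta> :: real
  assumes "\<alpha> \<ge> 0" "\<beta> \<ge> 0" "\<alpha> \<noteq> \<beta>"
  shows "\<exists>l. \<alpha> * exp (- l) + \<beta> * exp l < \<alpha> + \<beta>"
proof -
  \<comment> \<open>The optimal odds \<open>sqrt (\<alpha> / \<beta>)\<close> degenerate when a
    weight is \<open>0\<close>; the odds \<open>a / b\<close> lean the same way but stay between
    \<open>1 / 3\<close> and \<open>3\<close>.\<close>
  define a b where "a = 3 * \<alpha> + \<beta>" and "b = \<alpha> + 3 * \<beta>"
  have pos: "a > 0" "b > 0" "\<alpha> + \<beta> > 0" using assms by (auto simp: a_def b_def)
  define l where "l = ln (a / b)"
  have el: "exp l = a / b" "exp (- l) = b / a"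
    using pos by (auto simp: l_def exp_minus)
  have "\<alpha> + \<beta> - (\<alpha> * exp (- l) + \<beta> * exp l) = (a - b) * (\<alpha> * b - \<beta> * a) / (a * b)"
    unfolding el using pos by (simp add: field_simps)
  also have "(a - b) * (\<alpha> * b - \<beta> * a) = 2 * (\<alpha> - \<beta>)\<^sup>2 * (\<alpha> + \<beta>)"
    by (simp add: a_def b_def power2_eq_square algebra_simps)
  also have "2 * (\<alpha> - \<beta>)\<^sup>2 * (\<alpha> + \<beta>) / (a * b) > 0" using pos assms(3) by simp
  finally show ?thesis by (intro exI[of _ l]) simp
qed

lemma normalized_pmf:
  fixes D :: "'a \<Rightarrow> real"
  assumes "finite A" "\<And>x. x \<in> A \<Longrightarrow> D x \<ge> 0" "(\<Sum>x\<in>A. D x) > 0"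
  obtains p where "set_pmf p \<subseteq> A" "\<And>x. x \<in> A \<Longrightarrow> pmf p x = D x / (\<Sum>x\<in>A. D x)"
proof -
  define h where "h = (\<lambda>x. if x \<in> A then D x / (\<Sum>x\<in>A. D x) else 0)"
  have nn: "h x \<ge> 0" for x using assms by (auto simp: h_def)
  have "(\<integral>\<^sup>+x. ennreal (h x) \<partial>count_space UNIV) = (\<Sum>x\<in>A. ennreal (h x))"
    by (rule nn_integral_count_space'[OF assms(1)]) (auto simp: h_def)
  also have "\<dots> = ennreal (\<Sum>x\<in>A. h x)" using nn by (simp add: sum_ennreal)
  also have "(\<Sum>x\<in>A. h x) = 1" using assms(3) by (simp add: h_def flip: sum_divide_distrib)
  finally have "pmf (embed_pmf h) x = h x" for x
    using nn by (intro pmf_embed_pmf) auto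
  then show ?thesis
    by (intro that[of "embed_pmf h"]) (auto simp: set_pmf_iff h_def split: if_splits)
qed

lemma fibre_empty_R:
  assumes "fibre n f b = {}"
  shows "R n f = 0"
proof -
  have "R n f \<le> 0"
    using assms
    by (intro R_err_leI[where P = "return_pmf (Leaf (\<not> b))"]) (auto simp: indicator_def, metis (full_types) emptyE)
  then show ?thesis by simp
qed

text \<open>
  Weights that do not balance the two fibres admit a forecast with no queries at all.
\<close>

lemma forecast_for_weights:
  fixes \<mu> :: real
  assumes D: "\<forall>x\<in>fibre n f True \<union> fibre n f False. D x \<ge> 0" "\<exists>x\<in>fibre n f True \<union> fibre n f False. D x > 0"
    and \<mu>: "\<mu> \<ge> 0" "\<mu> * Corr n f \<le> 1 / 300"
  shows "\<exists>t. queries t \<subseteq> {..<n} \<and> depth t \<le> Corr n f \<and>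
    (\<Sum>x\<in>fibre n f True \<union> fibre n f False. D x * pay \<mu> t (the (f x)) (\<lambda>j. x ! j))
      < (\<Sum>x\<in>fibre n f True \<union> fibre n f False. D x)"
proof -
  let ?X = "fibre n f True \<union> fibre n f False"
  define s where "s = (\<lambda>b. \<Sum>x\<in>fibre n f b. D x)"
  have s_nonneg: "s b \<ge> 0" for b
    unfolding s_def using D(1) by (cases b) (auto intro!: sum_nonneg)
  have split: "(\<Sum>x\<in>?X. g x) = (\<Sum>x\<in>fibre n f True. g x) + (\<Sum>x\<in>fibre n f False. g x)" for g :: "bool list \<Rightarrow> real"
    by (intro sum.union_disjoint finite_fibre) (auto simp: fibre_def)
  have total: "(\<Sum>x\<in>?X. D x) = s True + s False" by (simp add: split s_def)
  show ?thesis
  proof (cases "s True = s False")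
    case False
    obtain l where l: "s True * exp (- l) + s False * exp l < s True + s False"
      using biased_label[OF s_nonneg s_nonneg False] by blast
    have "(\<Sum>x\<in>fibre n f b. D x * pay \<mu> (Leaf l) (the (f x)) (\<lambda>j. x ! j)) = s b * wt b l" for b
      unfolding s_def sum_distrib_right by (intro sum.cong) (auto simp: pay_def fibre_def)
    then show ?thesis
      using l unfolding total by (intro exI[of _ "Leaf l"]) (simp add: split wt_def)
  next
    case True
    \<comment> \<open>With equal masses, dividing by \<open>\<gamma>\<close> turns \<open>D\<close>
      into a probability distribution on each fibre, and the two form a balanced one.\<close>
    define \<gamma> where "\<gamma> = s True"
    have s: "s b = \<gamma>" for b using True by (cases b) (auto simp: \<gamma>_def)
    obtain x where x: "x \<in> ?X" "D x > 0" using D(2) by blast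
    have "(\<Sum>x\<in>?X. D x) > 0"
      by (rule sum_pos2[of _ x]) (use D(1) x finite_fibre in auto)
    then have \<gamma>: "\<gamma> > 0" by (simp add: total s)
    have "\<exists>p. set_pmf p \<subseteq> fibre n f b \<and> (\<forall>x\<in>fibre n f b. pmf p x = D x / \<gamma>)" for b
    proof -
      have "D x \<ge> 0" if "x \<in> fibre n f b" for x using that D(1) by (cases b) auto
      moreover have sb: "(\<Sum>x\<in>fibre n f b. D x) = \<gamma>" using s[of b] by (simp add: s_def)
      ultimately obtain p where
        "set_pmf p \<subseteq> fibre n f b" "\<And>x. x \<in> fibre n f b \<Longrightarrow> pmf p x = D x / (\<Sum>x\<in>fibre n f b. D x)"
        using \<gamma> by - (rule normalized_pmf[OF finite_fibre, of n f b D], auto)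
      then show ?thesis by (auto simp: sb)
    qed
    then obtain p where p: "\<And>b. set_pmf (p b) \<subseteq> fibre n f b" "\<And>b x. x \<in> fibre n f b \<Longrightarrow> pmf (p b) x = D x / \<gamma>"
      by metis
    have bal: "p \<in> balanced n f" using p(1) by (simp add: balanced_def)
    obtain k T where T: "k \<ge> 1" "queries T \<subseteq> {..<k} \<times> {..<n}" "depth T \<le> Corr n f"
      "measure_pmf.prob (half_mix (\<lambda>b. replicate_pmf k (p b)))
        {xs. run T (\<lambda>(i, j). xs ! i ! j) = map f xs} \<ge> 1 - 1 / 3"
      by (rule Corr_err_witness[OF _ bal, of "1 / 3"]) auto
    obtain t where t: "queries t \<subseteq> {..<n}" "depth t \<le> Corr n f"
      "(\<Sum>x\<in>?X. pmf (p (the (f x))) x / 2 * pay \<mu> t (the (f x)) (\<lambda>j. x ! j)) < 1"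
      using forecast_for_balanced[OF bal T(1-3) _ \<mu>] T(4) by auto
    have "(\<Sum>x\<in>?X. D x * pay \<mu> t (the (f x)) (\<lambda>j. x ! j))
        = 2 * \<gamma> * (\<Sum>x\<in>?X. pmf (p (the (f x))) x / 2 * pay \<mu> t (the (f x)) (\<lambda>j. x ! j))"
      unfolding sum_distrib_left
    proof (rule sum.cong[OF refl])
      fix x assume "x \<in> ?X"
      then have "pmf (p (the (f x))) x = D x / \<gamma>" by (intro p(2)) (auto simp: fibre_def)
      then show "D x * pay \<mu> t (the (f x)) (\<lambda>j. x ! j)
          = 2 * \<gamma> * (pmf (p (the (f x))) x / 2 * pay \<mu> t (the (f x)) (\<lambda>j. x ! j))"
        using \<gamma> by simp
    qed
    also have "\<dots> < 2 * \<gamma> * 1" using t(3) \<gamma> by (intro mult_strict_left_mono) auto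
    also have "\<dots> = (\<Sum>x\<in>?X. D x)" by (simp add: total s)
    finally show ?thesis using t(1,2) by blast
  qed
qed

text \<open>At depth \<open>0\<close> a forecast is a single label \<open>l\<close>, and
  \<open>exp (- l) + exp l \<ge> 2\<close> leaves no gain against one input of each value with equal
  weights. Positivity makes the division in \<open>\<mu> = 1 / (300 * d)\<close> meaningful.\<close>

lemma Corr_pos:
  assumes "fibre n f True \<noteq> {}" "fibre n f False \<noteq> {}"
  shows "Corr n f > 0"
proof (rule ccontr)
  assume "\<not> ?thesis"
  then have zero: "Corr n f = 0" by simp
  obtain x y where xy: "x \<in> fibre n f True" "y \<in> fibre n f False" using assms by auto
  then have f: "f x = Some True" "f y = Some False" "x \<noteq> y" by (auto simp: fibre_def)
  let ?X = "fibre n f True \<union> fibre n f False"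
  define D :: "bool list \<Rightarrow> real" where "D = (\<lambda>z. if z \<in> {x, y} then 1 else 0)"
  have sum_D: "(\<Sum>z\<in>?X. D z * g z) = g x + g y" for g
  proof -
    have "(\<Sum>z\<in>?X. D z * g z) = (\<Sum>z\<in>{x, y}. D z * g z)"
      using xy by (intro sum.mono_neutral_right) (auto simp: finite_fibre D_def)
    then show ?thesis using f by (simp add: D_def)
  qed
  have "\<forall>z\<in>?X. D z \<ge> 0" "\<exists>z\<in>?X. D z > 0"
    using xy by (auto simp: D_def)
  from forecast_for_weights[OF this, of 0]
  obtain t where t: "depth t \<le> 0"
    "(\<Sum>z\<in>?X. D z * pay 0 t (the (f z)) (\<lambda>j. z ! j)) < (\<Sum>z\<in>?X. D z * 1)"
    using zero by auto
  then obtain l where "t = Leaf l" by (cases t) auto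
  with t(2) have "exp (- l) + exp l < 2"
    unfolding sum_D by (simp add: pay_def wt_def f)
  moreover have "exp (- l) \<ge> 1 + - l" "exp l \<ge> 1 + l" by (rule exp_ge_add_one_self)+
  ultimately show False by linarith
qed

lemma R_le_Corr: "R n f \<le> 601 * Corr n f"
proof (cases "fibre n f True = {} \<or> fibre n f False = {}")
  case True
  then have "R n f = 0" by (auto intro: fibre_empty_R)
  then show ?thesis by simp
next
  case False
  let ?X = "fibre n f True \<union> fibre n f False"
  define d where "d = Corr n f"
  define \<mu> :: real where "\<mu> = 1 / (300 * d)"
  have d: "d > 0" using Corr_pos False by (auto simp: d_def)
  have \<mu>: "\<mu> \<ge> 0" "\<mu> * d \<le> 1 / 300" using d by (auto simp: \<mu>_def)
  obtain P where P: "finite (set_pmf P)" "set_pmf P \<subseteq> {t. queries t \<subseteq> {..<n} \<and> depth t \<le> d}"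
    "\<And>x. x \<in> ?X \<Longrightarrow> measure_pmf.expectation P (\<lambda>t. pay \<mu> t (the (f x)) (\<lambda>j. x ! j)) < 1"
  proof (rule finite_minimax[of ?X "{t. queries t \<subseteq> {..<n} \<and> depth t \<le> d}"
        "\<lambda>t x. pay \<mu> t (the (f x)) (\<lambda>j. x ! j)"])
    fix D :: "bool list \<Rightarrow> real"
    assume "\<forall>x\<in>?X. D x \<ge> 0" "\<exists>x\<in>?X. D x > 0"
    from forecast_for_weights[OF this \<mu>[unfolded d_def]]
    show "\<exists>t\<in>{t. queries t \<subseteq> {..<n} \<and> depth t \<le> d}.
      (\<Sum>x\<in>?X. D x * pay \<mu> t (the (f x)) (\<lambda>j. x ! j)) < (\<Sum>x\<in>?X. D x)"
      by (auto simp: d_def)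
  qed (use False finite_fibre in auto)
  \<comment> \<open>The budget \<open>600 * d\<close> makes \<open>\<mu> * B\<close> equal to
    \<open>2\<close>, and \<open>exp 2 > 3\<close>; the last \<open>d\<close> covers the tree still
    running when the budget is used up.\<close>
  have "R n f \<le> 600 * d + d"
  proof (rule R_le_of_forecast[OF P(1) \<mu>(1)])
    have "(2 :: real) * 2 \<le> exp 1 * exp 1"
      using exp_ge_add_one_self[of "1 :: real"] by (intro mult_mono) auto
    then have "exp (2 :: real) > 3" by (simp flip: exp_add)
    moreover have "- \<mu> * real (600 * d) = - 2" using d by (simp add: \<mu>_def)
    ultimately show "exp (- \<mu> * real (600 * d)) < 1 / 3"
      by (simp only: exp_minus) (simp add: field_simps)
  next
    fix t assume "t \<in> set_pmf P"
    then show "queries t \<subseteq> {..<n} \<and> depth t \<le> d" using P(2) by auto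
  next
    fix b x assume "x \<in> fibre n f b"
    moreover from this have "x \<in> ?X" "the (f x) = b" by (cases b; auto simp: fibre_def)+
    ultimately show "measure_pmf.expectation P (\<lambda>t. pay \<mu> t b (\<lambda>i. x ! i)) < 1"
      using P(3)[of x] by simp
  qed
  then show ?thesis by (simp add: d_def)
qed

theorem theorem2:
  shows "\<exists>c\<^sub>1 c\<^sub>2 :: real. c\<^sub>1 > 0 \<and> c\<^sub>2 > 0 \<and>
    (\<forall>n\<ge>1. \<forall>f :: bool list \<Rightarrow> bool option.
       c\<^sub>1 * real (R n f) \<le> real (Corr n f) \<and> real (Corr n f) \<le> c\<^sub>2 * real (R n f))"
proof (rule exI[of _ "1 / 601"], rule exI[of _ 1], intro conjI allI impI)
  fix n :: nat and f
  have "real (R n f) \<le> 601 * real (Corr n f)" using R_le_Corr[of n f] by linarith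
  then show "1 / 601 * real (R n f) \<le> real (Corr n f)" by simp
  show "real (Corr n f) \<le> 1 * real (R n f)" using Corr_err_le_R_err[of "1 / 3" n f] by simp
qed auto

end
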